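(* Let $(M,F)$ be an AR-Finsler manifold, with $g_{ij}=\eta\,a_{ij}$. Then the coefficients of the Barthel connection are given by $$\begin{aligned}N^j_{i}={}& \tfrac{1}{2}\left[ y^j\,\partial_i\log(\eta)+\delta^{j}_{i}\,y^k\,\partial_k\log(\eta)\right]\\&-\tfrac{1}{4}\,y^r\left(2\,a_{ir}\,a^{jl}+y^s\left[a^{jl}\,\dot{\partial}_{i}a_{rs}+a_{rs}\,\dot{\partial}_{i}a^{jl}\right]\right)\partial_l\log(\eta)\\&+\tfrac{1}{2}\left(y^j y^l-\tfrac{1}{2}\,y^r y^s\,a_{rs}\,a^{jl}\right)\dot{\partial}_{i}\partial_{l}\log(\eta)\\&+\tfrac{1}{2}\,\dot{\partial}_{i}\left(y^k y^s\,a^{lj}\left[\partial_{k}a_{ls}-\tfrac{1}{2}\,\partial_{l}a_{ks}\right]\right).\end{aligned}$$ Consequently, the $N^i_j(x,y)$ are (all) rational functions in $y$ if and only if the functions $\partial_k\log(\eta(x,y))$ are (all) rational in $y$.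
   Context: $M$ is a smooth $n$-dimensional manifold with local coordinates $(x^i)$ and induced fibre coordinates $(y^i)$ on $TM$; $\partial_i=\partial/\partial x^i$, $\dot{\partial}_i=\partial/\partial y^i$; the summation convention is used. A Finsler metric on $M$ is a map $F:TM\to[0,\infty)$ which is $C^\infty$ on $TM\setminus\{0\}$, positively homogeneous of degree one in $y$, and such that $g_{ij}(x,y):=\frac12\dot{\partial}_i\dot{\partial}_jF^2$ is positive definite at each point of $TM\setminus\{0\}$; $(g^{ij})$ is the inverse matrix. "Rational in $y$" means: locally in $x$, a quotient of two polynomials in $y$ whose coefficients are smooth functions of $x$. $F$ is an AR-Finsler metric (and $(M,F)$ an AR-Finsler manifold) if $g_{ij}(x,y)=\eta(x,y)\,a_{ij}(x,y)$ where (a) $\eta:TM\setminus\{0\}\to[0,\infty)$ is smooth; (b) $(a_{ij}(x,y))$ is a symmetric positive definite matrix with each $a_{ij}$ rational in $y$; (c) each product $\eta\,a_{ij}$ is positively homogeneous of degree zero in $y$. Such a decomposition is fixed, and $(a^{ij})$ is the inverse matrix of $(a_{ij})$. Spray coefficients: $G^i=\frac14 g^{ir}\left(y^k\dot{\partial}_r\partial_kF^2-\partial_rF^2\right)$; Barthel connection: $N^i_j=\dot{\partial}_jG^i$. *)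

theory Defs
  imports "HOL-Analysis.Analysis"
begin

section \<open>Smooth functions on open subsets of normed spaces\<close>

fun Ck_on :: "nat \<Rightarrow> 'a::real_normed_vector set \<Rightarrow> ('a \<Rightarrow> 'b::real_normed_vector) \<Rightarrow> bool" where
  "Ck_on 0 S f \<longleftrightarrow> continuous_on S f"
| "Ck_on (Suc k) S f \<longleftrightarrow>
     (\<forall>x\<in>S. f differentiable (at x)) \<and>
     (\<forall>v. Ck_on k S (\<lambda>x. frechet_derivative f (at x) v))"

text \<open>Only meant for open \<open>S\<close>.\<close>
definition smooth_on :: "'a::real_normed_vector set \<Rightarrow> ('a \<Rightarrow> 'b::real_normed_vector) \<Rightarrow> bool" where
  "smooth_on S f \<longleftrightarrow> (\<forall>k. Ck_on k S f)"


section \<open>Smooth manifolds and their tangent bundles\<close>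

text \<open>A chart is a domain together with a coordinate map; the values of the coordinate map outside
  the domain are irrelevant.  A manifold carries an arbitrary smooth atlas, not necessarily a maximal
  one, so whatever is proved for all charts of all atlases holds in particular for the charts of the
  maximal atlas.\<close>

type_synonym ('m, 'n) chart = "'m set \<times> ('m \<Rightarrow> real ^ 'n)"

definition chart_image :: "('m, 'n::finite) chart \<Rightarrow> (real ^ 'n) set" where
  "chart_image c = snd c ` fst c"

definition chart_of :: "'m topology \<Rightarrow> ('m, 'n::finite) chart \<Rightarrow> bool" where
  "chart_of M c \<longleftrightarrow> openin M (fst c) \<and> open (chart_image c) \<and>
     homeomorphic_map (subtopology M (fst c)) (top_of_set (chart_image c)) (snd c)"

definition transition :: "('m, 'n::finite) chart \<Rightarrow> ('m, 'n) chart \<Rightarrow> real ^ 'n \<Rightarrow> real ^ 'n" where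
  "transition c d = snd d \<circ> inv_into (fst c) (snd c)"

definition smooth_manifold :: "'m topology \<Rightarrow> ('m, 'n::finite) chart set \<Rightarrow> bool" where
  "smooth_manifold M \<A> \<longleftrightarrow>
     Hausdorff_space M \<and> second_countable M \<and>
     (\<forall>c\<in>\<A>. chart_of M c) \<and> (\<Union>c\<in>\<A>. fst c) = topspace M \<and>
     (\<forall>c\<in>\<A>. \<forall>d\<in>\<A>. smooth_on (snd c ` (fst c \<inter> fst d)) (transition c d))"

text \<open>A tangent vector at \<open>p\<close> is the family of its components with respect to all charts around
  \<open>p\<close>, subject to the vector transformation law.  The components with respect to
  any other chart are set to zero, so that each tangent vector is represented by exactly one
  function and the vector space operations are pointwise.\<close>

type_synonym ('m, 'n) tvec = "('m, 'n) chart \<Rightarrow> real ^ 'n"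

definition tangent_vector :: "('m, 'n::finite) chart set \<Rightarrow> 'm \<Rightarrow> ('m, 'n) tvec \<Rightarrow> bool" where
  "tangent_vector \<A> p v \<longleftrightarrow>
     (\<forall>c\<in>\<A>. \<forall>d\<in>\<A>. p \<in> fst c \<and> p \<in> fst d \<longrightarrow>
        v d = frechet_derivative (transition c d) (at (snd c p)) (v c)) \<and>
     (\<forall>c. \<not> (c \<in> \<A> \<and> p \<in> fst c) \<longrightarrow> v c = 0)"

definition tangent_bundle :: "'m topology \<Rightarrow> ('m, 'n::finite) chart set \<Rightarrow> ('m \<times> ('m, 'n) tvec) set" where
  "tangent_bundle M \<A> = {(p, v). p \<in> topspace M \<and> tangent_vector \<A> p v}"

definition slit_tangent_bundle :: "'m topology \<Rightarrow> ('m, 'n::finite) chart set \<Rightarrow> ('m \<times> ('m, 'n) tvec) set" where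
  "slit_tangent_bundle M \<A> = {(p, v) \<in> tangent_bundle M \<A>. v \<noteq> (\<lambda>_. 0)}"

text \<open>The coordinates \<open>(x\<^sup>i, y\<^sup>i)\<close> induced on the part of the tangent bundle lying over the domain of a
  chart, and the expression of a function on the tangent bundle in these coordinates.\<close>

definition induced_coords :: "('m, 'n::finite) chart \<Rightarrow> 'm \<times> ('m, 'n) tvec \<Rightarrow> (real ^ 'n) \<times> (real ^ 'n)" where
  "induced_coords c = (\<lambda>(p, v). (snd c p, v c))"

definition in_coords :: "'m topology \<Rightarrow> ('m, 'n::finite) chart set \<Rightarrow> ('m, 'n) chart \<Rightarrow>
    ('m \<times> ('m, 'n) tvec \<Rightarrow> real) \<Rightarrow> real ^ 'n \<Rightarrow> real ^ 'n \<Rightarrow> real" where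
  "in_coords M \<A> c f x y =
     f (inv_into {(p, v) \<in> tangent_bundle M \<A>. p \<in> fst c} (induced_coords c) (x, y))"

definition smooth_on_slit :: "'m topology \<Rightarrow> ('m, 'n::finite) chart set \<Rightarrow>
    ('m \<times> ('m, 'n) tvec \<Rightarrow> real) \<Rightarrow> bool" where
  "smooth_on_slit M \<A> f \<longleftrightarrow>
     (\<forall>c\<in>\<A>. smooth_on (chart_image c \<times> (- {0})) (\<lambda>(x, y). in_coords M \<A> c f x y))"


section \<open>Partial derivatives and rationality in the fibre coordinates\<close>

definition dx :: "'n::finite \<Rightarrow> (real ^ 'n \<Rightarrow> real ^ 'n \<Rightarrow> real) \<Rightarrow> real ^ 'n \<Rightarrow> real ^ 'n \<Rightarrow> real" where
  "dx i f x y = deriv (\<lambda>t. f (x + t *\<^sub>R axis i 1) y) 0"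

definition dy :: "'n::finite \<Rightarrow> (real ^ 'n \<Rightarrow> real ^ 'n \<Rightarrow> real) \<Rightarrow> real ^ 'n \<Rightarrow> real ^ 'n \<Rightarrow> real" where
  "dy i f x y = deriv (\<lambda>t. f x (y + t *\<^sub>R axis i 1)) 0"

text \<open>Polynomials in \<open>y\<close> whose coefficients are smooth functions of \<open>x \<in> V\<close>; \<open>\<alpha>\<close> is a multi-index.\<close>

definition polynomial_in_y :: "(real ^ 'n::finite) set \<Rightarrow> (real ^ 'n \<Rightarrow> real ^ 'n \<Rightarrow> real) \<Rightarrow> bool" where
  "polynomial_in_y V P \<longleftrightarrow>
     (\<exists>I :: ('n \<Rightarrow> nat) set. \<exists>coef. finite I \<and> (\<forall>\<alpha>\<in>I. smooth_on V (coef \<alpha>)) \<and>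
        (\<forall>x\<in>V. \<forall>y. P x y = (\<Sum>\<alpha>\<in>I. coef \<alpha> x * (\<Prod>i\<in>UNIV. (y $ i) ^ \<alpha> i))))"

text \<open>The functions in question live on the slit tangent bundle, so they have to be honest quotients
  at every \<open>y \<noteq> 0\<close>: the denominator has no zero there.\<close>

definition rational_in_y :: "(real ^ 'n::finite) set \<Rightarrow> (real ^ 'n \<Rightarrow> real ^ 'n \<Rightarrow> real) \<Rightarrow> bool" where
  "rational_in_y U f \<longleftrightarrow>
     (\<forall>x0\<in>U. \<exists>V P Q. open V \<and> x0 \<in> V \<and> V \<subseteq> U \<and> polynomial_in_y V P \<and> polynomial_in_y V Q \<and>
        (\<forall>x\<in>V. \<forall>y. y \<noteq> 0 \<longrightarrow> Q x y \<noteq> 0 \<and> f x y = P x y / Q x y))"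


section \<open>Finsler metrics\<close>

definition pos_def :: "real ^ 'n ^ 'n::finite \<Rightarrow> bool" where
  "pos_def A \<longleftrightarrow> (\<forall>v. v \<noteq> 0 \<longrightarrow> v \<bullet> (A *v v) > 0)"

text \<open>In the following, \<open>f\<close> is the coordinate expression of a Finsler metric in one chart.\<close>

definition fundamental_tensor :: "(real ^ 'n::finite \<Rightarrow> real ^ 'n \<Rightarrow> real) \<Rightarrow> real ^ 'n \<Rightarrow> real ^ 'n \<Rightarrow> real ^ 'n ^ 'n" where
  "fundamental_tensor f x y = (\<chi> i j. 1/2 * dy i (dy j (\<lambda>x y. (f x y)\<^sup>2)) x y)"

definition Finsler_metric :: "'m topology \<Rightarrow> ('m, 'n::finite) chart set \<Rightarrow>
    ('m \<times> ('m, 'n) tvec \<Rightarrow> real) \<Rightarrow> bool" where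
  "Finsler_metric M \<A> F \<longleftrightarrow>
     (\<forall>u\<in>tangent_bundle M \<A>. F u \<ge> 0) \<and>
     smooth_on_slit M \<A> F \<and>
     (\<forall>(p, v)\<in>tangent_bundle M \<A>. \<forall>l>0. F (p, \<lambda>c. l *\<^sub>R v c) = l * F (p, v)) \<and>
     (\<forall>c\<in>\<A>. \<forall>x\<in>chart_image c. \<forall>y. y \<noteq> 0 \<longrightarrow>
        pos_def (fundamental_tensor (in_coords M \<A> c F) x y))"

definition spray_coeff :: "(real ^ 'n::finite \<Rightarrow> real ^ 'n \<Rightarrow> real) \<Rightarrow> 'n \<Rightarrow> real ^ 'n \<Rightarrow> real ^ 'n \<Rightarrow> real" where
  "spray_coeff f i x y =
     1/4 * (\<Sum>r\<in>UNIV. matrix_inv (fundamental_tensor f x y) $ i $ r *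
       ((\<Sum>k\<in>UNIV. y $ k * dy r (dx k (\<lambda>x y. (f x y)\<^sup>2)) x y) - dx r (\<lambda>x y. (f x y)\<^sup>2) x y))"

text \<open>\<open>barthel f i j\<close> has the upper index \<open>i\<close> and the lower index \<open>j\<close>.\<close>

definition barthel :: "(real ^ 'n::finite \<Rightarrow> real ^ 'n \<Rightarrow> real) \<Rightarrow> 'n \<Rightarrow> 'n \<Rightarrow> real ^ 'n \<Rightarrow> real ^ 'n \<Rightarrow> real" where
  "barthel f i j = dy j (spray_coeff f i)"

text \<open>AR-Finsler metrics with a fixed decomposition \<open>g\<^sub>i\<^sub>j = \<eta> a\<^sub>i\<^sub>j\<close>: here \<open>\<eta>\<close> is a function on the slit
  tangent bundle, while the matrix \<open>a c x y\<close> depends on the chart \<open>c\<close>.\<close>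

definition AR_Finsler_metric :: "'m topology \<Rightarrow> ('m, 'n::finite) chart set \<Rightarrow>
    ('m \<times> ('m, 'n) tvec \<Rightarrow> real) \<Rightarrow> ('m \<times> ('m, 'n) tvec \<Rightarrow> real) \<Rightarrow>
    (('m, 'n) chart \<Rightarrow> real ^ 'n \<Rightarrow> real ^ 'n \<Rightarrow> real ^ 'n ^ 'n) \<Rightarrow> bool" where
  "AR_Finsler_metric M \<A> F \<eta> a \<longleftrightarrow>
     Finsler_metric M \<A> F \<and>
     (\<forall>u\<in>slit_tangent_bundle M \<A>. \<eta> u \<ge> 0) \<and> smooth_on_slit M \<A> \<eta> \<and>
     (\<forall>c\<in>\<A>.
        (\<forall>x\<in>chart_image c. \<forall>y. y \<noteq> 0 \<longrightarrow>
           fundamental_tensor (in_coords M \<A> c F) x y = in_coords M \<A> c \<eta> x y *\<^sub>R a c x y \<and>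
           transpose (a c x y) = a c x y \<and> pos_def (a c x y) \<and>
           (\<forall>i j. \<forall>l>0. in_coords M \<A> c \<eta> x (l *\<^sub>R y) * a c x (l *\<^sub>R y) $ i $ j =
                        in_coords M \<A> c \<eta> x y * a c x y $ i $ j)) \<and>
        (\<forall>i j. rational_in_y (chart_image c) (\<lambda>x y. a c x y $ i $ j)))"

end

theory Submission
  imports Defs
begin

text \<open>
  Since \<open>F\<^sup>2\<close> is homogeneous of degree two, Euler's identity expresses \<open>F\<^sup>2\<close> and its fibre derivatives
  through \<open>g\<^sub>i\<^sub>j = \<eta> a\<^sub>i\<^sub>j\<close>. Together with the symmetry of mixed partial derivatives this gives
  \<open>2 G\<^sup>j = y\<^sup>j S - \<alpha>/2 a\<^sup>j\<^sup>l \<partial>\<^sub>l log \<eta> + T\<^sup>j\<close>, where \<open>S = y\<^sup>k \<partial>\<^sub>k log \<eta>\<close>, \<open>\<alpha> = a\<^sub>r\<^sub>s y\<^sup>r y\<^sup>s > 0\<close> and \<open>T\<close> is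
  built from \<open>a\<close> alone, hence rational by Cramer's rule. The formula for \<open>N\<close> is the product rule.
  Conversely \<open>2 G\<^sup>j = y\<^sup>i N\<^sup>j\<^sub>i\<close>, so rationality of \<open>N\<close> gives that of \<open>G\<close>; contracting
  \<open>R = 2 G - T\<close> with \<open>a\<^sub>i\<^sub>j y\<^sup>i\<close> yields \<open>\<alpha> S / 2\<close>, and then lowering the index of \<open>R\<close> isolates \<open>\<partial>\<^sub>l log \<eta>\<close>.
\<close>


section \<open>Smooth functions\<close>

text \<open>Only the product \<eta> a is homogeneous, so neither log \<eta> nor \<open>a\<close> may
  be treated as homogeneous on its own. Euler's identity is therefore applied only to F^2, its fibre
  derivatives and the spray, and the degree of the spray is read off its definition rather than off
  the formula for it. The entries of \<open>a\<close> are known to be rational, not smooth: all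
  their derivatives come from the representation as quotients of polynomials with smooth
  coefficients, which also shows that these derivatives are rational. Mixed partial derivatives are
  interchanged because the fibre derivative of F^2 in direction r has the closed form 2 \<eta> a_rs
  y^s. Differentiating this in x produces \<partial>_k log \<eta> but no fibre derivative of \<eta>,
  so \<eta> cancels against the inverse metric and the spray is linear in the functions \<partial>_k
  log \<eta>. In N, their fibre derivatives occur as well; this is why the converse goes back from N
  to the spray, where the problem is linear algebra at each point.\<close>

text \<open>Derivative rules hold only at points of \<open>S\<close>, so they can rewrite a function
  under \<open>Ck_on\<close> only through this congruence; openness of \<open>S\<close> lets
  agreement on \<open>S\<close> pass to the derivatives.\<close>

lemma Ck_on_cong:
  assumes "Ck_on k S f" "open S" "\<And>x. x \<in> S \<Longrightarrow> f x = g x"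
  shows "Ck_on k S g"
  using assms
proof (induction k arbitrary: f g)
  case 0
  then show ?case by (metis Ck_on.simps(1) continuous_on_cong)
next
  case (Suc k)
  have diff: "f differentiable (at x)" if "x \<in> S" for x
    using Suc.prems that by simp
  have "g differentiable (at x)" if "x \<in> S" for x
    using diff[OF that] Suc.prems(2,3) that
    by (meson differentiable_def has_derivative_transform_within_open)
  moreover have "Ck_on k S (\<lambda>x. frechet_derivative g (at x) v)" for v
  proof (rule Suc.IH[of "\<lambda>x. frechet_derivative f (at x) v"])
    show "Ck_on k S (\<lambda>x. frechet_derivative f (at x) v)" using Suc.prems by simp
    show "frechet_derivative f (at x) v = frechet_derivative g (at x) v" if "x \<in> S" for x
      using frechet_derivative_transform_within_open[OF diff[OF that] Suc.prems(2) that Suc.prems(3)] by simp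
  qed fact
  ultimately show ?case by simp
qed

lemma Ck_on_Suc_D: "Ck_on (Suc k) S f \<Longrightarrow> Ck_on k S f"
proof (induction k arbitrary: f)
  case 0
  then show ?case
    by (auto intro!: continuous_at_imp_continuous_on differentiable_imp_continuous_within)
qed simp

lemma Ck_on_const: "Ck_on k S (\<lambda>_. c)"
  by (induction k arbitrary: c) auto

lemma Ck_on_add: "Ck_on k S f \<Longrightarrow> Ck_on k S g \<Longrightarrow> open S \<Longrightarrow> Ck_on k S (\<lambda>x. f x + g x)"
proof (induction k arbitrary: f g)
  case 0
  then show ?case by (simp add: continuous_on_add)
next
  case (Suc k)
  have "Ck_on k S (\<lambda>x. frechet_derivative (\<lambda>x. f x + g x) (at x) v)" for v
  proof (rule Ck_on_cong[OF Suc.IH])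
    show "frechet_derivative f (at x) v + frechet_derivative g (at x) v
        = frechet_derivative (\<lambda>x. f x + g x) (at x) v" if "x \<in> S" for x
    proof -
      have "((\<lambda>x. f x + g x) has_derivative
          (\<lambda>v. frechet_derivative f (at x) v + frechet_derivative g (at x) v)) (at x)"
        using Suc.prems that by (intro has_derivative_add) (auto simp: frechet_derivative_works)
      from frechet_derivative_at[OF this] show ?thesis by metis
    qed
  qed (use Suc.prems in auto)
  with Suc.prems show ?case by (simp add: differentiable_add)
qed

lemma Ck_on_mult:
  fixes f g :: "'a::real_normed_vector \<Rightarrow> 'b::real_normed_algebra"
  shows "Ck_on k S f \<Longrightarrow> Ck_on k S g \<Longrightarrow> open S \<Longrightarrow> Ck_on k S (\<lambda>x. f x * g x)"
proof (induction k arbitrary: f g)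
  case 0
  then show ?case by (simp add: continuous_on_mult)
next
  case (Suc k)
  have "Ck_on k S (\<lambda>x. frechet_derivative (\<lambda>x. f x * g x) (at x) v)" for v
  proof (rule Ck_on_cong[OF Ck_on_add])
    \<comment> \<open>The product rule pairs a derivative of order k with an undifferentiated factor
      of order k + 1; the latter gives up one order to fit the induction hypothesis.\<close>
    show "Ck_on k S (\<lambda>x. f x * frechet_derivative g (at x) v)"
      using Suc.prems by (intro Suc.IH) (auto intro: Ck_on_Suc_D simp del: Ck_on.simps simp: Ck_on.simps(2)[of k S g])
    show "Ck_on k S (\<lambda>x. frechet_derivative f (at x) v * g x)"
      using Suc.prems by (intro Suc.IH) (auto intro: Ck_on_Suc_D simp del: Ck_on.simps simp: Ck_on.simps(2)[of k S f])
    show "f x * frechet_derivative g (at x) v + frechet_derivative f (at x) v * g x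
        = frechet_derivative (\<lambda>x. f x * g x) (at x) v" if "x \<in> S" for x
    proof -
      have "((\<lambda>x. f x * g x) has_derivative
          (\<lambda>v. f x * frechet_derivative g (at x) v + frechet_derivative f (at x) v * g x)) (at x)"
        using Suc.prems that by (intro has_derivative_mult) (auto simp: frechet_derivative_works)
      from frechet_derivative_at[OF this] show ?thesis by metis
    qed
  qed (use Suc.prems in auto)
  with Suc.prems show ?case by (simp add: differentiable_mult)
qed

lemma smooth_on_const: "smooth_on S (\<lambda>_. c)"
  by (simp add: smooth_on_def Ck_on_const)

lemma smooth_on_add: "smooth_on S f \<Longrightarrow> smooth_on S g \<Longrightarrow> open S \<Longrightarrow> smooth_on S (\<lambda>x. f x + g x)"
  by (simp add: smooth_on_def Ck_on_add)

lemma smooth_on_mult: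
  fixes f g :: "'a::real_normed_vector \<Rightarrow> 'b::real_normed_algebra"
  shows "smooth_on S f \<Longrightarrow> smooth_on S g \<Longrightarrow> open S \<Longrightarrow> smooth_on S (\<lambda>x. f x * g x)"
  by (simp add: smooth_on_def Ck_on_mult)

lemma smooth_on_cong: "smooth_on S f \<Longrightarrow> open S \<Longrightarrow> (\<And>x. x \<in> S \<Longrightarrow> f x = g x) \<Longrightarrow> smooth_on S g"
  unfolding smooth_on_def using Ck_on_cong by blast

lemma smooth_on_subset: "smooth_on S f \<Longrightarrow> T \<subseteq> S \<Longrightarrow> smooth_on T f"
proof -
  assume T: "T \<subseteq> S"
  have "Ck_on k S f \<Longrightarrow> Ck_on k T f" for k
    using T by (induction k arbitrary: f) (auto intro: continuous_on_subset)
  then show "smooth_on S f \<Longrightarrow> smooth_on T f" by (simp add: smooth_on_def)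
qed

lemma smooth_on_differentiable: "smooth_on S f \<Longrightarrow> x \<in> S \<Longrightarrow> f differentiable (at x)"
  unfolding smooth_on_def using Ck_on.simps(2) by blast

lemma smooth_on_continuous_on: "smooth_on S f \<Longrightarrow> continuous_on S f"
  unfolding smooth_on_def using Ck_on.simps(1) by blast

lemma smooth_on_frechet_derivative:
  "smooth_on S f \<Longrightarrow> smooth_on S (\<lambda>x. frechet_derivative f (at x) v)"
  unfolding smooth_on_def using Ck_on.simps(2) by blast

section \<open>Directional derivatives and their symmetry\<close>

lemma DERIV_along_line:
  fixes f :: "'a::real_normed_vector \<Rightarrow> real"
  assumes "f differentiable (at (p + t *\<^sub>R v))"
  shows "((\<lambda>t. f (p + t *\<^sub>R v)) has_field_derivative frechet_derivative f (at (p + t *\<^sub>R v)) v) (at t)"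
proof -
  let ?D = "frechet_derivative f (at (p + t *\<^sub>R v))"
  have f: "(f has_derivative ?D) (at (p + t *\<^sub>R v))"
    using assms by (simp add: frechet_derivative_works)
  have "((\<lambda>t. f (p + t *\<^sub>R v)) has_derivative (\<lambda>s. ?D (0 + s *\<^sub>R v))) (at t)"
    by (rule has_derivative_compose[where g = f and f = "\<lambda>t. p + t *\<^sub>R v"])
      (auto intro!: derivative_eq_intros f)
  moreover have "(\<lambda>s. ?D (0 + s *\<^sub>R v)) = (*) (?D v)"
    using linear_frechet_derivative[OF assms] by (auto simp: linear_cmul mult.commute)
  ultimately show ?thesis by (simp add: has_field_derivative_def)
qed

text \<open>Two mean value theorems: first for the function s \<mapsto> f (p + h v + s u) - f (p + s
  u), whose increment over [0, h] is the second difference, then for the derivative in direction u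
  along v.\<close>

lemma second_difference_mvt:
  fixes f :: "'a::real_normed_vector \<Rightarrow> real"
  assumes f: "smooth_on S f" and h: "h > 0"
    and sub: "\<And>s t. 0 \<le> s \<Longrightarrow> s \<le> h \<Longrightarrow> 0 \<le> t \<Longrightarrow> t \<le> h \<Longrightarrow> p + s *\<^sub>R u + t *\<^sub>R v \<in> S"
  obtains s t where "0 < s" "s < h" "0 < t" "t < h"
    "f (p + h *\<^sub>R u + h *\<^sub>R v) - f (p + h *\<^sub>R u) - f (p + h *\<^sub>R v) + f p =
      h * h * frechet_derivative (\<lambda>x. frechet_derivative f (at x) u) (at (p + s *\<^sub>R u + t *\<^sub>R v)) v"
proof -
  define fu where "fu x = frechet_derivative f (at x) u" for x
  have fu: "smooth_on S fu" unfolding fu_def using f by (rule smooth_on_frechet_derivative)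
  have d1: "((\<lambda>s. f (p + h *\<^sub>R v + s *\<^sub>R u) - f (p + s *\<^sub>R u)) has_field_derivative
      fu (p + h *\<^sub>R v + s *\<^sub>R u) - fu (p + s *\<^sub>R u)) (at s)" if "0 \<le> s" "s \<le> h" for s
    unfolding fu_def using sub[of s h] sub[of s 0] h that
    by (intro DERIV_diff DERIV_along_line smooth_on_differentiable[OF f]) (auto simp: algebra_simps)
  obtain s where s: "0 < s" "s < h" and
    eq1: "f (p + h *\<^sub>R v + h *\<^sub>R u) - f (p + h *\<^sub>R u) - (f (p + h *\<^sub>R v) - f p) =
      h * (fu (p + h *\<^sub>R v + s *\<^sub>R u) - fu (p + s *\<^sub>R u))"
    using MVT2[OF h d1] by auto
  have d2: "((\<lambda>t. fu (p + s *\<^sub>R u + t *\<^sub>R v)) has_field_derivative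
      frechet_derivative fu (at (p + s *\<^sub>R u + t *\<^sub>R v)) v) (at t)" if "0 \<le> t" "t \<le> h" for t
    using sub[of s t] s that by (intro DERIV_along_line smooth_on_differentiable[OF fu]) auto
  obtain t where t: "0 < t" "t < h" and
    eq2: "fu (p + s *\<^sub>R u + h *\<^sub>R v) - fu (p + s *\<^sub>R u) =
      h * frechet_derivative fu (at (p + s *\<^sub>R u + t *\<^sub>R v)) v"
    using MVT2[OF h d2] by auto
  have "f (p + h *\<^sub>R u + h *\<^sub>R v) - f (p + h *\<^sub>R u) - f (p + h *\<^sub>R v) + f p =
      h * (fu (p + s *\<^sub>R u + h *\<^sub>R v) - fu (p + s *\<^sub>R u))"
    using eq1 by (simp add: add_ac)
  also have "\<dots> = h * h * frechet_derivative fu (at (p + s *\<^sub>R u + t *\<^sub>R v)) v"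
    using eq2 by simp
  finally show thesis using that[OF s t] by (simp add: fu_def[abs_def])
qed

text \<open>The second difference over the parallelogram spanned by h u and h v is unchanged when u
  and v are exchanged, so the two mixed derivatives agree at two points near \<open>p\<close>,
  possibly different ones; continuity brings both points to \<open>p\<close>.\<close>

lemma frechet_derivative_commute:
  fixes f :: "'a::real_normed_vector \<Rightarrow> real"
  assumes S: "open S" and f: "smooth_on S f" and p: "p \<in> S"
  shows "frechet_derivative (\<lambda>x. frechet_derivative f (at x) u) (at p) v =
         frechet_derivative (\<lambda>x. frechet_derivative f (at x) v) (at p) u"
proof (rule ccontr)
  define A where "A u v x = frechet_derivative (\<lambda>x. frechet_derivative f (at x) u) (at x) v" for u v x
  assume "\<not> ?thesis"
  then have ne: "A u v p \<noteq> A v u p" by (simp add: A_def)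
  \<comment> \<open>Half the gap: no number is within \<open>e\<close> of both values.\<close>
  define e where "e = \<bar>A u v p - A v u p\<bar> / 2"
  have e: "e > 0" using ne by (simp add: e_def)
  have cont: "isCont (A u v) p" for u v
  proof -
    have "smooth_on S (A u v)"
      unfolding A_def by (intro smooth_on_frechet_derivative f)
    then show ?thesis
      using S p smooth_on_continuous_on continuous_on_eq_continuous_at by blast
  qed
  obtain d1 where d1: "d1 > 0" "\<And>x. dist x p < d1 \<Longrightarrow> dist (A u v x) (A u v p) < e"
    using cont[of u v, unfolded continuous_at_eps_delta] e by blast
  obtain d2 where d2: "d2 > 0" "\<And>x. dist x p < d2 \<Longrightarrow> dist (A v u x) (A v u p) < e"
    using cont[of v u, unfolded continuous_at_eps_delta] e by blast
  obtain d3 where d3: "d3 > 0" "\<And>x. dist x p < d3 \<Longrightarrow> x \<in> S"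
    using S p unfolding open_dist by blast
  define d where "d = min d1 (min d2 d3)"
  have d: "d > 0" using d1 d2 d3 by (simp add: d_def)
  \<comment> \<open>The summand 1 keeps \<open>K\<close> positive when u and v both vanish; with h =
    d / (2 K) the whole parallelogram lies within d / 2 of \<open>p\<close>.\<close>
  define K where "K = norm u + norm v + 1"
  have K: "K > 0" unfolding K_def by (smt (verit) norm_ge_zero)
  define h where "h = d / (2 * K)"
  have h: "h > 0" using d K by (simp add: h_def)
  have near: "dist (p + s *\<^sub>R u + t *\<^sub>R v) p < d" if "0 \<le> s" "s \<le> h" "0 \<le> t" "t \<le> h" for s t
  proof -
    have "dist (p + s *\<^sub>R u + t *\<^sub>R v) p = norm (s *\<^sub>R u + t *\<^sub>R v)"
      by (simp add: dist_norm algebra_simps)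
    also have "\<dots> \<le> s * norm u + t * norm v" using norm_triangle_ineq[of "s *\<^sub>R u" "t *\<^sub>R v"] that by simp
    also have "\<dots> \<le> h * norm u + h * norm v" using that by (intro add_mono mult_right_mono) auto
    also have "\<dots> \<le> h * K" using h by (simp add: K_def algebra_simps)
    also have "\<dots> = d / 2" using K by (simp add: h_def)
    finally show ?thesis using d by simp
  qed
  have near': "dist (p + s *\<^sub>R v + t *\<^sub>R u) p < d" if "0 \<le> s" "s \<le> h" "0 \<le> t" "t \<le> h" for s t
    using near[of t s] that by (simp add: add_ac)
  obtain s t where st: "0 < s" "s < h" "0 < t" "t < h" and
    eq1: "f (p + h *\<^sub>R u + h *\<^sub>R v) - f (p + h *\<^sub>R u) - f (p + h *\<^sub>R v) + f p =
      h * h * A u v (p + s *\<^sub>R u + t *\<^sub>R v)"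
    unfolding A_def using near d3(2)
    by (rule_tac second_difference_mvt[OF f h, of p u v]) (auto simp: d_def)
  obtain s' t' where st': "0 < s'" "s' < h" "0 < t'" "t' < h" and
    eq2: "f (p + h *\<^sub>R v + h *\<^sub>R u) - f (p + h *\<^sub>R v) - f (p + h *\<^sub>R u) + f p =
      h * h * A v u (p + s' *\<^sub>R v + t' *\<^sub>R u)"
    unfolding A_def using near' d3(2)
    by (rule_tac second_difference_mvt[OF f h, of p v u]) (auto simp: d_def)
  have "h * h * A u v (p + s *\<^sub>R u + t *\<^sub>R v) = h * h * A v u (p + s' *\<^sub>R v + t' *\<^sub>R u)"
    using eq1 eq2 by (simp add: algebra_simps)
  then have "A u v (p + s *\<^sub>R u + t *\<^sub>R v) = A v u (p + s' *\<^sub>R v + t' *\<^sub>R u)" using h by simp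
  moreover have "dist (A u v (p + s *\<^sub>R u + t *\<^sub>R v)) (A u v p) < e"
    using near[of s t] st by (intro d1) (auto simp: d_def)
  moreover have "dist (A v u (p + s' *\<^sub>R v + t' *\<^sub>R u)) (A v u p) < e"
    using near'[of s' t'] st' by (intro d2) (auto simp: d_def)
  ultimately show False unfolding e_def dist_real_def by argo
qed


section \<open>Partial derivatives\<close>

lemma DERIV_dx:
  assumes "(\<lambda>(x, y). f x y) differentiable (at (x, y))"
  shows "((\<lambda>t. f (x + t *\<^sub>R axis i 1) y) has_field_derivative dx i f x y) (at 0)"
    and "dx i f x y = frechet_derivative (\<lambda>(x, y). f x y) (at (x, y)) (axis i 1, 0)"
proof -
  have "((\<lambda>t. (\<lambda>(x, y). f x y) ((x, y) + t *\<^sub>R (axis i 1, 0))) has_field_derivative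
      frechet_derivative (\<lambda>(x, y). f x y) (at (x, y)) (axis i 1, 0)) (at 0)"
    using assms DERIV_along_line[of "\<lambda>(x, y). f x y" "(x, y)" 0 "(axis i 1, 0)"] by simp
  then have *: "((\<lambda>t. f (x + t *\<^sub>R axis i 1) y) has_field_derivative
      frechet_derivative (\<lambda>(x, y). f x y) (at (x, y)) (axis i 1, 0)) (at 0)"
    by simp
  then show "dx i f x y = frechet_derivative (\<lambda>(x, y). f x y) (at (x, y)) (axis i 1, 0)"
    unfolding dx_def by (rule DERIV_imp_deriv)
  with * show "((\<lambda>t. f (x + t *\<^sub>R axis i 1) y) has_field_derivative dx i f x y) (at 0)"
    by simp
qed

text \<open>Differentiability is required along the fibre only, since this is applied to entries of
  \<open>a\<close> and its inverse, where it comes from rationality in y.\<close>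

lemma DERIV_dy:
  assumes "f x differentiable (at y)"
  shows "((\<lambda>t. f x (y + t *\<^sub>R axis i 1)) has_field_derivative dy i f x y) (at 0)"
    and "dy i f x y = frechet_derivative (f x) (at y) (axis i 1)"
proof -
  have *: "((\<lambda>t. f x (y + t *\<^sub>R axis i 1)) has_field_derivative
      frechet_derivative (f x) (at y) (axis i 1)) (at 0)"
    using assms DERIV_along_line[of "f x" y 0] by simp
  then show "dy i f x y = frechet_derivative (f x) (at y) (axis i 1)"
    unfolding dy_def by (rule DERIV_imp_deriv)
  with * show "((\<lambda>t. f x (y + t *\<^sub>R axis i 1)) has_field_derivative dy i f x y) (at 0)"
    by simp
qed

lemma differentiable_in_y:
  assumes "(\<lambda>(x, y). f x y) differentiable (at (x, y))"
  shows "f x differentiable (at y)"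
    and "frechet_derivative (f x) (at y) v = frechet_derivative (\<lambda>(x, y). f x y) (at (x, y)) (0, v)"
proof -
  have "((\<lambda>y. (\<lambda>(x, y). f x y) (x, y)) has_derivative
      (\<lambda>v. frechet_derivative (\<lambda>(x, y). f x y) (at (x, y)) (0, v))) (at y)"
    by (rule has_derivative_compose[where f = "\<lambda>y. (x, y)"])
      (use assms in \<open>auto intro!: derivative_eq_intros simp: frechet_derivative_works\<close>)
  then have *: "(f x has_derivative
      (\<lambda>v. frechet_derivative (\<lambda>(x, y). f x y) (at (x, y)) (0, v))) (at y)"
    by simp
  then show "f x differentiable (at y)" by (rule differentiableI)
  show "frechet_derivative (f x) (at y) v = frechet_derivative (\<lambda>(x, y). f x y) (at (x, y)) (0, v)"
    using frechet_derivative_at[OF *] by metis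
qed

text \<open>\<open>dx\<close> and \<open>dy\<close> are derivatives at 0 along a line; an identity
  on an open set transfers to them once the line is known to stay inside for small
  parameters.\<close>

lemma eventually_along_line:
  fixes x v :: "'a::real_normed_vector"
  assumes "open S" "x \<in> S"
  shows "eventually (\<lambda>t. x + t *\<^sub>R v \<in> S) (nhds 0)"
proof -
  have "((\<lambda>t. x + t *\<^sub>R v) \<longlongrightarrow> x + 0 *\<^sub>R v) (nhds 0)"
    by (intro tendsto_intros filterlim_ident)
  then have "((\<lambda>t. x + t *\<^sub>R v) \<longlongrightarrow> x) (nhds 0)" by simp
  then show ?thesis using assms by (rule topological_tendstoD)
qed

lemma dx_cong:
  assumes "open S" "x \<in> S" "\<And>x. x \<in> S \<Longrightarrow> f x y = g x y"
  shows "dx i f x y = dx i g x y"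
  unfolding dx_def using eventually_along_line[OF assms(1,2), of "axis i 1"]
  by (intro deriv_cong_ev) (auto elim!: eventually_mono simp: assms(3))

lemma dy_cong:
  assumes "y \<noteq> 0" "\<And>y. y \<noteq> 0 \<Longrightarrow> f x y = g x y"
  shows "dy i f x y = dy i g x y"
  unfolding dy_def using eventually_along_line[of "- {0}" y "axis i 1"] assms
  by (intro deriv_cong_ev) (auto elim!: eventually_mono simp: open_Compl)

lemma differentiable_prod:
  fixes f :: "'i \<Rightarrow> 'a::real_normed_vector \<Rightarrow> real"
  shows "(\<And>i. i \<in> I \<Longrightarrow> f i differentiable (at x)) \<Longrightarrow> (\<lambda>x. \<Prod>i\<in>I. f i x) differentiable (at x)"
  by (induction I rule: infinite_finite_induct) (auto intro: differentiable_mult)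

lemma differentiable_vec_nth [simp]: "(\<lambda>y. y $ i) differentiable (at (y :: real ^ 'n))"
  by (simp add: bounded_linear_imp_differentiable bounded_linear_vec_nth)


section \<open>Polynomials and rational functions in the fibre coordinates\<close>

lemma polynomial_in_y_cong:
  "polynomial_in_y V P \<Longrightarrow> (\<And>x y. x \<in> V \<Longrightarrow> P x y = Q x y) \<Longrightarrow> polynomial_in_y V Q"
  unfolding polynomial_in_y_def by (elim exE conjE, intro exI conjI) auto

lemma polynomial_in_y_subset: "polynomial_in_y V P \<Longrightarrow> W \<subseteq> V \<Longrightarrow> polynomial_in_y W P"
  unfolding polynomial_in_y_def by (meson smooth_on_subset subsetD)

lemma polynomial_in_y_monomial:
  assumes "smooth_on V c"
  shows "polynomial_in_y V (\<lambda>x y. c x * (\<Prod>i\<in>UNIV. (y $ i) ^ \<alpha> i))"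
  unfolding polynomial_in_y_def
  by (rule exI[of _ "{\<alpha>}"], rule exI[of _ "\<lambda>_. c"]) (use assms in auto)

lemma polynomial_in_y_base: "smooth_on V c \<Longrightarrow> polynomial_in_y V (\<lambda>x y. c x)"
  using polynomial_in_y_monomial[of V c "\<lambda>_. 0"] by simp

lemma polynomial_in_y_const: "polynomial_in_y V (\<lambda>x y. c)"
  using polynomial_in_y_base smooth_on_const by blast

lemma polynomial_in_y_coord: "polynomial_in_y V (\<lambda>x y. y $ i)"
proof (rule polynomial_in_y_cong[OF polynomial_in_y_monomial[OF smooth_on_const]])
  show "1 * (\<Prod>j\<in>UNIV. (y $ j) ^ (if j = i then 1 else 0)) = y $ i" for y
    by (simp add: if_distrib[where f = "\<lambda>n. _ ^ n"] prod.delta cong: if_cong)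
qed

lemma polynomial_in_y_add:
  assumes "polynomial_in_y V P" "polynomial_in_y V Q" "open V"
  shows "polynomial_in_y V (\<lambda>x y. P x y + Q x y)"
proof -
  obtain I c where I: "finite I" "\<And>\<alpha>. \<alpha> \<in> I \<Longrightarrow> smooth_on V (c \<alpha>)"
    "\<And>x y. x \<in> V \<Longrightarrow> P x y = (\<Sum>\<alpha>\<in>I. c \<alpha> x * (\<Prod>i\<in>UNIV. (y $ i) ^ \<alpha> i))"
    using assms(1) unfolding polynomial_in_y_def by blast
  obtain J d where J: "finite J" "\<And>\<alpha>. \<alpha> \<in> J \<Longrightarrow> smooth_on V (d \<alpha>)"
    "\<And>x y. x \<in> V \<Longrightarrow> Q x y = (\<Sum>\<alpha>\<in>J. d \<alpha> x * (\<Prod>i\<in>UNIV. (y $ i) ^ \<alpha> i))"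
    using assms(2) unfolding polynomial_in_y_def by blast
  \<comment> \<open>Both coefficient families are extended by zero to the union of the index sets,
    so that a shared multi-index adds its coefficients.\<close>
  let ?e = "\<lambda>\<alpha> x. (if \<alpha> \<in> I then c \<alpha> x else 0) + (if \<alpha> \<in> J then d \<alpha> x else 0)"
  have "smooth_on V (?e \<alpha>)" for \<alpha>
    using assms(3) I(2)[of \<alpha>] J(2)[of \<alpha>]
    by (cases "\<alpha> \<in> I"; cases "\<alpha> \<in> J") (simp_all add: smooth_on_add smooth_on_const)
  moreover have "P x y + Q x y = (\<Sum>\<alpha>\<in>I \<union> J. ?e \<alpha> x * (\<Prod>i\<in>UNIV. (y $ i) ^ \<alpha> i))" if "x \<in> V" for x y
  proof -
    have "P x y = (\<Sum>\<alpha>\<in>I \<union> J. (if \<alpha> \<in> I then c \<alpha> x else 0) * (\<Prod>i\<in>UNIV. (y $ i) ^ \<alpha> i))"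
      unfolding I(3)[OF that] using I(1) J(1) by (intro sum.mono_neutral_cong_left) auto
    moreover have "Q x y = (\<Sum>\<alpha>\<in>I \<union> J. (if \<alpha> \<in> J then d \<alpha> x else 0) * (\<Prod>i\<in>UNIV. (y $ i) ^ \<alpha> i))"
      unfolding J(3)[OF that] using I(1) J(1) by (intro sum.mono_neutral_cong_left) auto
    ultimately show ?thesis by (simp only: distrib_right sum.distrib)
  qed
  ultimately show ?thesis
    unfolding polynomial_in_y_def using I(1) J(1)
    by (intro exI[of _ "I \<union> J"] exI[of _ ?e]) auto
qed

lemma polynomial_in_y_sum:
  "(\<And>k. k \<in> K \<Longrightarrow> polynomial_in_y V (P k)) \<Longrightarrow> open V \<Longrightarrow> polynomial_in_y V (\<lambda>x y. \<Sum>k\<in>K. P k x y)"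
  by (induction K rule: infinite_finite_induct)
    (auto intro: polynomial_in_y_const polynomial_in_y_add)

lemma polynomial_in_y_mult:
  assumes "polynomial_in_y V P" "polynomial_in_y V Q" "open V"
  shows "polynomial_in_y V (\<lambda>x y. P x y * Q x y)"
proof -
  obtain I c where I: "finite I" "\<And>\<alpha>. \<alpha> \<in> I \<Longrightarrow> smooth_on V (c \<alpha>)"
    "\<And>x y. x \<in> V \<Longrightarrow> P x y = (\<Sum>\<alpha>\<in>I. c \<alpha> x * (\<Prod>i\<in>UNIV. (y $ i) ^ \<alpha> i))"
    using assms(1) unfolding polynomial_in_y_def by blast
  obtain J d where J: "finite J" "\<And>\<alpha>. \<alpha> \<in> J \<Longrightarrow> smooth_on V (d \<alpha>)"
    "\<And>x y. x \<in> V \<Longrightarrow> Q x y = (\<Sum>\<alpha>\<in>J. d \<alpha> x * (\<Prod>i\<in>UNIV. (y $ i) ^ \<alpha> i))"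
    using assms(2) unfolding polynomial_in_y_def by blast
  \<comment> \<open>Multi-indices add. Different pairs may give the same sum;
    \<open>polynomial_in_y_sum\<close> takes care of collecting them.\<close>
  have "polynomial_in_y V (\<lambda>x y. \<Sum>\<alpha>\<in>I. \<Sum>\<beta>\<in>J. (c \<alpha> x * d \<beta> x) * (\<Prod>i\<in>UNIV. (y $ i) ^ (\<alpha> i + \<beta> i)))"
    using I(2) J(2) assms(3)
    by (intro polynomial_in_y_sum polynomial_in_y_monomial smooth_on_mult)
  then show ?thesis
    by (rule polynomial_in_y_cong)
      (simp add: I(3) J(3) sum_product power_add prod.distrib mult_ac)
qed

lemma polynomial_in_y_power:
  "polynomial_in_y V P \<Longrightarrow> open V \<Longrightarrow> polynomial_in_y V (\<lambda>x y. P x y ^ k)"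
  by (induction k) (auto intro: polynomial_in_y_const polynomial_in_y_mult)

lemma polynomial_in_y_prod:
  "(\<And>k. k \<in> K \<Longrightarrow> polynomial_in_y V (P k)) \<Longrightarrow> open V \<Longrightarrow> polynomial_in_y V (\<lambda>x y. \<Prod>k\<in>K. P k x y)"
  by (induction K rule: infinite_finite_induct)
    (auto intro: polynomial_in_y_const polynomial_in_y_mult)

lemma polynomial_in_y_differentiable:
  assumes "polynomial_in_y V P" "x \<in> V"
  shows "P x differentiable (at y)"
proof -
  obtain I c where "\<And>y. P x y = (\<Sum>\<alpha>\<in>I. c \<alpha> x * (\<Prod>i\<in>UNIV. (y $ i) ^ \<alpha> i))" and "finite I"
    using assms unfolding polynomial_in_y_def by blast
  then have "P x = (\<lambda>y. \<Sum>\<alpha>\<in>I. c \<alpha> x * (\<Prod>i\<in>UNIV. (y $ i) ^ \<alpha> i))" by blast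
  then show ?thesis
    using \<open>finite I\<close> by (auto intro!: differentiable_sum differentiable_mult differentiable_prod differentiable_power)
qed

lemma polynomial_in_y_dy:
  assumes "polynomial_in_y V P" "open V"
  shows "polynomial_in_y V (dy i P)"
proof -
  obtain I c where I: "finite I" "\<And>\<alpha>. \<alpha> \<in> I \<Longrightarrow> smooth_on V (c \<alpha>)"
    "\<And>x y. x \<in> V \<Longrightarrow> P x y = (\<Sum>\<alpha>\<in>I. c \<alpha> x * (\<Prod>i\<in>UNIV. (y $ i) ^ \<alpha> i))"
    using assms(1) unfolding polynomial_in_y_def by blast
  \<comment> \<open>Claiming only that the derivative is some polynomial lets the induction add one
    coordinate at a time, without tracking multi-indices lowered in the place
    \<open>i\<close>.\<close>
  have prod: "\<exists>Q. polynomial_in_y V Q \<and> (\<forall>x\<in>V. \<forall>y.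
      ((\<lambda>t. \<Prod>j\<in>J. ((y + t *\<^sub>R axis i 1) $ j) ^ \<alpha> j) has_field_derivative Q x y) (at 0))"
    for J :: "'a set" and \<alpha> :: "'a \<Rightarrow> nat"
  proof (induction J rule: infinite_finite_induct)
    case (insert k J)
    then obtain Q where Q: "polynomial_in_y V Q" "\<And>x y. x \<in> V \<Longrightarrow>
      ((\<lambda>t. \<Prod>j\<in>J. ((y + t *\<^sub>R axis i 1) $ j) ^ \<alpha> j) has_field_derivative Q x y) (at 0)"
      by blast
    \<comment> \<open>If \<alpha> k = 0, the truncated exponent \<alpha> k - 1 is harmless because
      the factor \<open>of_nat (\<alpha> k)\<close> vanishes.\<close>
    have "((\<lambda>t. \<Prod>j\<in>insert k J. ((y + t *\<^sub>R axis i 1) $ j) ^ \<alpha> j) has_field_derivative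
        of_nat (\<alpha> k) * (y $ k) ^ (\<alpha> k - 1) * axis i 1 $ k * (\<Prod>j\<in>J. (y $ j) ^ \<alpha> j)
        + Q x y * (y $ k) ^ \<alpha> k) (at 0)" if "x \<in> V" for x y
      using insert.hyps by (auto intro!: derivative_eq_intros Q(2)[OF that, simplified])
    moreover have "polynomial_in_y V (\<lambda>x y. of_nat (\<alpha> k) * (y $ k) ^ (\<alpha> k - 1) * axis i 1 $ k
        * (\<Prod>j\<in>J. (y $ j) ^ \<alpha> j) + Q x y * (y $ k) ^ \<alpha> k)"
      by (intro polynomial_in_y_add polynomial_in_y_mult polynomial_in_y_prod polynomial_in_y_power
          polynomial_in_y_const polynomial_in_y_coord Q(1) assms(2))
    ultimately show ?case by (intro exI conjI) auto
  qed (auto intro!: exI[of _ "\<lambda>_ _. 0"] polynomial_in_y_const)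
  have "\<exists>Q. \<forall>\<alpha>. polynomial_in_y V (Q \<alpha>) \<and> (\<forall>x\<in>V. \<forall>y.
      ((\<lambda>t. \<Prod>j\<in>UNIV. ((y + t *\<^sub>R axis i 1) $ j) ^ \<alpha> j) has_field_derivative Q \<alpha> x y) (at 0))"
    by (intro choice allI prod)
  then obtain Q where Q: "\<And>\<alpha>. polynomial_in_y V (Q \<alpha>)" "\<And>\<alpha> x y. x \<in> V \<Longrightarrow>
      ((\<lambda>t. \<Prod>j\<in>UNIV. ((y + t *\<^sub>R axis i 1) $ j) ^ \<alpha> j) has_field_derivative Q \<alpha> x y) (at 0)"
    by blast
  have "polynomial_in_y V (\<lambda>x y. \<Sum>\<alpha>\<in>I. c \<alpha> x * Q \<alpha> x y)"
    by (intro polynomial_in_y_sum polynomial_in_y_mult polynomial_in_y_base I Q assms(2))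
  moreover have "(\<Sum>\<alpha>\<in>I. c \<alpha> x * Q \<alpha> x y) = dy i P x y" if "x \<in> V" for x y
  proof -
    have "((\<lambda>t. P x (y + t *\<^sub>R axis i 1)) has_field_derivative (\<Sum>\<alpha>\<in>I. c \<alpha> x * Q \<alpha> x y)) (at 0)"
      unfolding I(3)[OF that] by (intro DERIV_sum DERIV_cmult Q(2) that)
    from DERIV_imp_deriv[OF this] show ?thesis unfolding dy_def by simp
  qed
  ultimately show ?thesis by (rule polynomial_in_y_cong)
qed

lemma polynomial_in_y_dx:
  assumes "polynomial_in_y V P" "open V"
  shows "polynomial_in_y V (dx i P)"
    and "x \<in> V \<Longrightarrow> ((\<lambda>t. P (x + t *\<^sub>R axis i 1) y) has_field_derivative dx i P x y) (at 0)"
proof -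
  obtain I c where I: "finite I" "\<And>\<alpha>. \<alpha> \<in> I \<Longrightarrow> smooth_on V (c \<alpha>)"
    "\<And>x y. x \<in> V \<Longrightarrow> P x y = (\<Sum>\<alpha>\<in>I. c \<alpha> x * (\<Prod>i\<in>UNIV. (y $ i) ^ \<alpha> i))"
    using assms(1) unfolding polynomial_in_y_def by blast
  let ?Q = "\<lambda>x y. \<Sum>\<alpha>\<in>I. frechet_derivative (c \<alpha>) (at x) (axis i 1) * (\<Prod>i\<in>UNIV. (y $ i) ^ \<alpha> i)"
  have *: "((\<lambda>t. P (x + t *\<^sub>R axis i 1) y) has_field_derivative ?Q x y) (at 0)" if x: "x \<in> V" for x y
  proof -
    have c: "((\<lambda>t. c \<alpha> (x + t *\<^sub>R axis i 1)) has_field_derivative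
        frechet_derivative (c \<alpha>) (at x) (axis i 1)) (at 0)" if "\<alpha> \<in> I" for \<alpha>
      using DERIV_along_line[of "c \<alpha>" x 0 "axis i 1"] smooth_on_differentiable[OF I(2)[OF that] x] by simp
    have "((\<lambda>t. \<Sum>\<alpha>\<in>I. c \<alpha> (x + t *\<^sub>R axis i 1) * (\<Prod>i\<in>UNIV. (y $ i) ^ \<alpha> i)) has_field_derivative ?Q x y) (at 0)"
      by (intro DERIV_sum DERIV_cmult_right c)
    \<comment> \<open>\<open>P\<close> is given by the sum only over \<open>V\<close>, but the
      shifted point stays in the open set \<open>V\<close> for small t.\<close>
    then show ?thesis
      using eventually_along_line[OF assms(2) x, of "axis i 1"]
      by (subst DERIV_cong_ev[OF refl _ refl]) (auto elim!: eventually_mono simp: I(3))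
  qed
  have eq: "?Q x y = dx i P x y" if "x \<in> V" for x y
    unfolding dx_def using DERIV_imp_deriv[OF *[OF that]] by simp
  have "polynomial_in_y V ?Q"
    by (intro polynomial_in_y_sum polynomial_in_y_monomial smooth_on_frechet_derivative I assms(2))
  then show "polynomial_in_y V (dx i P)" using eq by (rule polynomial_in_y_cong)
  show "x \<in> V \<Longrightarrow> ((\<lambda>t. P (x + t *\<^sub>R axis i 1) y) has_field_derivative dx i P x y) (at 0)"
    using *[of x y] by (simp add: eq)
qed

section \<open>Quotients of polynomials and their closure properties\<close>

text \<open>The local half of \<open>rational_in_y\<close>: one numerator and one denominator serve
  all of \<open>V\<close>, so closure properties reduce to arithmetic of fractions.\<close>

definition polynomial_quotient :: "(real ^ 'n::finite) set \<Rightarrow> (real ^ 'n \<Rightarrow> real ^ 'n \<Rightarrow> real) \<Rightarrow> bool" where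
  "polynomial_quotient V f \<longleftrightarrow> (\<exists>P Q. polynomial_in_y V P \<and> polynomial_in_y V Q \<and>
     (\<forall>x\<in>V. \<forall>y. y \<noteq> 0 \<longrightarrow> Q x y \<noteq> 0 \<and> f x y = P x y / Q x y))"

lemma rational_in_y_altdef:
  "rational_in_y U f \<longleftrightarrow> (\<forall>x0\<in>U. \<exists>V. open V \<and> x0 \<in> V \<and> V \<subseteq> U \<and> polynomial_quotient V f)"
  unfolding rational_in_y_def polynomial_quotient_def by (intro ball_cong refl) blast

lemma polynomial_quotient_subset: "polynomial_quotient V f \<Longrightarrow> W \<subseteq> V \<Longrightarrow> polynomial_quotient W f"
  unfolding polynomial_quotient_def by (meson polynomial_in_y_subset subsetD)

lemma polynomial_quotientI:
  "polynomial_in_y V P \<Longrightarrow> polynomial_in_y V Q \<Longrightarrow>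
   (\<And>x y. x \<in> V \<Longrightarrow> y \<noteq> 0 \<Longrightarrow> Q x y \<noteq> 0 \<and> f x y = P x y / Q x y) \<Longrightarrow> polynomial_quotient V f"
  unfolding polynomial_quotient_def by blast

lemma polynomial_quotientE:
  assumes "polynomial_quotient V f"
  obtains P Q where "polynomial_in_y V P" "polynomial_in_y V Q"
    "\<And>x y. x \<in> V \<Longrightarrow> y \<noteq> 0 \<Longrightarrow> Q x y \<noteq> 0" "\<And>x y. x \<in> V \<Longrightarrow> y \<noteq> 0 \<Longrightarrow> f x y = P x y / Q x y"
  using assms unfolding polynomial_quotient_def by blast

text \<open>Two rational functions come with different neighbourhoods of a point; both
  representations survive on the intersection. Unary operations use the case where \<open>f\<close>
  and \<open>g\<close> coincide.\<close>

lemma rational_in_y_binop: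
  assumes "rational_in_y U f" "rational_in_y U g"
    and "\<And>V. open V \<Longrightarrow> V \<subseteq> U \<Longrightarrow> polynomial_quotient V f \<Longrightarrow> polynomial_quotient V g \<Longrightarrow> polynomial_quotient V h"
  shows "rational_in_y U h"
  unfolding rational_in_y_altdef
proof
  fix x0 assume "x0 \<in> U"
  then obtain V W where "open V" "x0 \<in> V" "V \<subseteq> U" "polynomial_quotient V f"
      "open W" "x0 \<in> W" "W \<subseteq> U" "polynomial_quotient W g"
    using assms(1,2) unfolding rational_in_y_altdef by meson
  then show "\<exists>V. open V \<and> x0 \<in> V \<and> V \<subseteq> U \<and> polynomial_quotient V h"
    by (intro exI[of _ "V \<inter> W"] conjI assms(3)) (auto intro: polynomial_quotient_subset)
qed

lemma rational_in_y_polynomial: "polynomial_in_y U P \<Longrightarrow> open U \<Longrightarrow> rational_in_y U P"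
  unfolding rational_in_y_altdef
  by (auto intro!: exI[of _ U] polynomial_quotientI[where P = P and Q = "\<lambda>_ _. 1"] polynomial_in_y_const)

lemma rational_in_y_const: "open U \<Longrightarrow> rational_in_y U (\<lambda>x y. c)"
  by (intro rational_in_y_polynomial polynomial_in_y_const)

lemma rational_in_y_coord: "open U \<Longrightarrow> rational_in_y U (\<lambda>x y. y $ i)"
  by (intro rational_in_y_polynomial polynomial_in_y_coord)

lemma rational_in_y_cong:
  assumes "rational_in_y U f" "\<And>x y. x \<in> U \<Longrightarrow> y \<noteq> 0 \<Longrightarrow> f x y = g x y"
  shows "rational_in_y U g"
  by (rule rational_in_y_binop[OF assms(1,1)])
    (use assms(2) in \<open>auto simp: polynomial_quotient_def subset_eq\<close>)

lemma rational_in_y_add: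
  assumes "rational_in_y U f" "rational_in_y U g"
  shows "rational_in_y U (\<lambda>x y. f x y + g x y)"
  using assms
proof (rule rational_in_y_binop)
  fix V assume V: "open V" and f: "polynomial_quotient V f" and g: "polynomial_quotient V g"
  from f obtain P Q where P: "polynomial_in_y V P" "polynomial_in_y V Q"
      "\<And>x y. x \<in> V \<Longrightarrow> y \<noteq> 0 \<Longrightarrow> Q x y \<noteq> 0" "\<And>x y. x \<in> V \<Longrightarrow> y \<noteq> 0 \<Longrightarrow> f x y = P x y / Q x y"
    by (rule polynomial_quotientE) blast
  from g obtain P' Q' where P': "polynomial_in_y V P'" "polynomial_in_y V Q'"
      "\<And>x y. x \<in> V \<Longrightarrow> y \<noteq> 0 \<Longrightarrow> Q' x y \<noteq> 0" "\<And>x y. x \<in> V \<Longrightarrow> y \<noteq> 0 \<Longrightarrow> g x y = P' x y / Q' x y"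
    by (rule polynomial_quotientE) blast
  show "polynomial_quotient V (\<lambda>x y. f x y + g x y)"
  proof (rule polynomial_quotientI)
    show "polynomial_in_y V (\<lambda>x y. P x y * Q' x y + P' x y * Q x y)"
      by (intro polynomial_in_y_add polynomial_in_y_mult P P' V)
    show "polynomial_in_y V (\<lambda>x y. Q x y * Q' x y)"
      by (intro polynomial_in_y_mult P P' V)
  qed (use P(3,4) P'(3,4) in \<open>simp add: add_frac_eq\<close>)
qed

lemma rational_in_y_mult:
  assumes "rational_in_y U f" "rational_in_y U g"
  shows "rational_in_y U (\<lambda>x y. f x y * g x y)"
  using assms
proof (rule rational_in_y_binop)
  fix V assume V: "open V" and f: "polynomial_quotient V f" and g: "polynomial_quotient V g"
  from f obtain P Q where P: "polynomial_in_y V P" "polynomial_in_y V Q"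
      "\<And>x y. x \<in> V \<Longrightarrow> y \<noteq> 0 \<Longrightarrow> Q x y \<noteq> 0" "\<And>x y. x \<in> V \<Longrightarrow> y \<noteq> 0 \<Longrightarrow> f x y = P x y / Q x y"
    by (rule polynomial_quotientE) blast
  from g obtain P' Q' where P': "polynomial_in_y V P'" "polynomial_in_y V Q'"
      "\<And>x y. x \<in> V \<Longrightarrow> y \<noteq> 0 \<Longrightarrow> Q' x y \<noteq> 0" "\<And>x y. x \<in> V \<Longrightarrow> y \<noteq> 0 \<Longrightarrow> g x y = P' x y / Q' x y"
    by (rule polynomial_quotientE) blast
  show "polynomial_quotient V (\<lambda>x y. f x y * g x y)"
    by (rule polynomial_quotientI[OF polynomial_in_y_mult[OF P(1) P'(1) V] polynomial_in_y_mult[OF P(2) P'(2) V]])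
      (use P(3,4) P'(3,4) in simp)
qed

text \<open>Numerator and denominator change places; since \<open>f\<close> has no zero off the zero
  section, the old numerator is an admissible denominator.\<close>

lemma rational_in_y_inverse:
  assumes "rational_in_y U f" "\<And>x y. x \<in> U \<Longrightarrow> y \<noteq> 0 \<Longrightarrow> f x y \<noteq> 0"
  shows "rational_in_y U (\<lambda>x y. inverse (f x y))"
  using assms(1,1)
proof (rule rational_in_y_binop)
  fix V assume "V \<subseteq> U" "polynomial_quotient V f"
  then obtain P Q where P: "polynomial_in_y V P" "polynomial_in_y V Q"
      "\<And>x y. x \<in> V \<Longrightarrow> y \<noteq> 0 \<Longrightarrow> Q x y \<noteq> 0 \<and> f x y = P x y / Q x y"
    unfolding polynomial_quotient_def by blast
  show "polynomial_quotient V (\<lambda>x y. inverse (f x y))"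
    by (rule polynomial_quotientI[OF P(2,1)])
      (use P(3) assms(2) \<open>V \<subseteq> U\<close> in \<open>metis div_0 inverse_divide subsetD\<close>)
qed

lemma rational_in_y_divide:
  assumes "rational_in_y U f" "rational_in_y U g" "\<And>x y. x \<in> U \<Longrightarrow> y \<noteq> 0 \<Longrightarrow> g x y \<noteq> 0"
  shows "rational_in_y U (\<lambda>x y. f x y / g x y)"
  unfolding divide_inverse using assms by (intro rational_in_y_mult rational_in_y_inverse)

lemma rational_in_y_diff:
  assumes "rational_in_y U f" "rational_in_y U g" "open U"
  shows "rational_in_y U (\<lambda>x y. f x y - g x y)"
  using rational_in_y_add[OF assms(1) rational_in_y_mult[OF rational_in_y_const[OF assms(3), of "-1"] assms(2)]]
  by simp

lemma rational_in_y_sum: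
  "open U \<Longrightarrow> (\<And>k. k \<in> K \<Longrightarrow> rational_in_y U (f k)) \<Longrightarrow> rational_in_y U (\<lambda>x y. \<Sum>k\<in>K. f k x y)"
  by (induction K rule: infinite_finite_induct) (auto intro: rational_in_y_const rational_in_y_add)

lemma rational_in_y_prod:
  "open U \<Longrightarrow> (\<And>k. k \<in> K \<Longrightarrow> rational_in_y U (f k)) \<Longrightarrow> rational_in_y U (\<lambda>x y. \<Prod>k\<in>K. f k x y)"
  by (induction K rule: infinite_finite_induct) (auto intro: rational_in_y_const rational_in_y_mult)

lemma rational_in_y_det:
  fixes A :: "real ^ 'n \<Rightarrow> real ^ 'n \<Rightarrow> real ^ 'm ^ 'm"
  assumes "open U" "\<And>i j. rational_in_y U (\<lambda>x y. A x y $ i $ j)"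
  shows "rational_in_y U (\<lambda>x y. det (A x y))"
  unfolding det_def
  by (intro rational_in_y_sum rational_in_y_mult rational_in_y_prod rational_in_y_const assms)

lemma rational_in_y_differentiable:
  assumes f: "rational_in_y U f" and x: "x \<in> U" and y: "y \<noteq> 0"
  shows "f x differentiable (at y)"
proof -
  obtain V P Q where P: "x \<in> V" "polynomial_in_y V P" "polynomial_in_y V Q"
      "\<And>x y. x \<in> V \<Longrightarrow> y \<noteq> 0 \<Longrightarrow> Q x y \<noteq> 0 \<and> f x y = P x y / Q x y"
    using f x unfolding rational_in_y_def by meson
  have "(\<lambda>y. P x y / Q x y) differentiable (at y)"
    using P y by (intro differentiable_divide polynomial_in_y_differentiable[of V]) auto
  moreover have "open (- {0 :: real ^ 'a})" by auto
  ultimately show ?thesis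
    using P(1,4) y has_derivative_transform_within_open[of "\<lambda>y. P x y / Q x y" _ y UNIV "- {0}" "f x"]
    unfolding differentiable_def by (metis ComplD ComplI singletonD singletonI)
qed

lemma rational_in_y_dy:
  assumes "rational_in_y U f"
  shows "rational_in_y U (dy i f)"
  using assms assms
proof (rule rational_in_y_binop)
  fix V assume V: "open V" and "polynomial_quotient V f"
  then obtain P Q where P: "polynomial_in_y V P" "polynomial_in_y V Q"
      "\<And>x y. x \<in> V \<Longrightarrow> y \<noteq> 0 \<Longrightarrow> Q x y \<noteq> 0 \<and> f x y = P x y / Q x y"
    unfolding polynomial_quotient_def by blast
  show "polynomial_quotient V (dy i f)"
  proof (rule polynomial_quotientI)
    show "polynomial_in_y V (\<lambda>x y. dy i P x y * Q x y + -1 * (P x y * dy i Q x y))"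
      by (intro polynomial_in_y_add polynomial_in_y_mult polynomial_in_y_dy polynomial_in_y_const P V)
    show "polynomial_in_y V (\<lambda>x y. Q x y * Q x y)"
      by (intro polynomial_in_y_mult P V)
    fix x y :: "real ^ 'a" assume x: "x \<in> V" and y: "y \<noteq> 0"
    have "((\<lambda>t. P x (y + t *\<^sub>R axis i 1) / Q x (y + t *\<^sub>R axis i 1)) has_field_derivative
        (dy i P x y * Q x (y + 0 *\<^sub>R axis i 1) - P x (y + 0 *\<^sub>R axis i 1) * dy i Q x y) /
        (Q x (y + 0 *\<^sub>R axis i 1) * Q x (y + 0 *\<^sub>R axis i 1))) (at 0)"
      using P(1,2) P(3)[OF x y] x by (intro DERIV_divide DERIV_dy polynomial_in_y_differentiable[of V]) auto
    then have "dy i (\<lambda>x y. P x y / Q x y) x y = (dy i P x y * Q x y - P x y * dy i Q x y) / (Q x y * Q x y)"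
      unfolding dy_def[of _ "\<lambda>x y. P x y / Q x y"] using DERIV_imp_deriv by fastforce
    moreover have "dy i f x y = dy i (\<lambda>x y. P x y / Q x y) x y"
      using P(3)[OF x] y by (intro dy_cong) auto
    ultimately show "Q x y * Q x y \<noteq> 0 \<and>
        dy i f x y = (dy i P x y * Q x y + -1 * (P x y * dy i Q x y)) / (Q x y * Q x y)"
      using P(3)[OF x y] by simp
  qed
qed

text \<open>A base derivative compares neighbouring values of x, so the same numerator and
  denominator must serve an open set of base points; the quotient rule then applies.\<close>

lemma polynomial_quotient_dx:
  assumes "polynomial_quotient V f" "open V"
  shows "polynomial_quotient V (dx i f)"
    and "x \<in> V \<Longrightarrow> y \<noteq> 0 \<Longrightarrow> ((\<lambda>t. f (x + t *\<^sub>R axis i 1) y) has_field_derivative dx i f x y) (at 0)"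
proof -
  obtain P Q where P: "polynomial_in_y V P" "polynomial_in_y V Q"
      "\<And>x y. x \<in> V \<Longrightarrow> y \<noteq> 0 \<Longrightarrow> Q x y \<noteq> 0 \<and> f x y = P x y / Q x y"
    using assms(1) unfolding polynomial_quotient_def by blast
  let ?D = "\<lambda>x y. (dx i P x y * Q x y - P x y * dx i Q x y) / (Q x y * Q x y)"
  have *: "((\<lambda>t. f (x + t *\<^sub>R axis i 1) y) has_field_derivative ?D x y) (at 0)"
    if x: "x \<in> V" and y: "y \<noteq> 0" for x y
  proof -
    have "((\<lambda>t. P (x + t *\<^sub>R axis i 1) y / Q (x + t *\<^sub>R axis i 1) y) has_field_derivative
        (dx i P x y * Q (x + 0 *\<^sub>R axis i 1) y - P (x + 0 *\<^sub>R axis i 1) y * dx i Q x y) /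
        (Q (x + 0 *\<^sub>R axis i 1) y * Q (x + 0 *\<^sub>R axis i 1) y)) (at 0)"
      using P(1,2) P(3)[OF x y] x assms(2) by (intro DERIV_divide polynomial_in_y_dx(2)) auto
    then show ?thesis
      using eventually_along_line[OF assms(2) x, of "axis i 1"] P(3) y
      by (subst DERIV_cong_ev[OF refl _ refl]) (auto elim!: eventually_mono)
  qed
  have eq: "dx i f x y = ?D x y" if "x \<in> V" "y \<noteq> 0" for x y
    unfolding dx_def[of i f] using DERIV_imp_deriv[OF *[OF that]] .
  show "x \<in> V \<Longrightarrow> y \<noteq> 0 \<Longrightarrow> ((\<lambda>t. f (x + t *\<^sub>R axis i 1) y) has_field_derivative dx i f x y) (at 0)"
    using *[of x y] by (simp add: eq)
  show "polynomial_quotient V (dx i f)"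
  proof (rule polynomial_quotientI)
    show "polynomial_in_y V (\<lambda>x y. dx i P x y * Q x y + -1 * (P x y * dx i Q x y))"
      by (intro polynomial_in_y_add polynomial_in_y_mult polynomial_in_y_dx polynomial_in_y_const P assms)
    show "polynomial_in_y V (\<lambda>x y. Q x y * Q x y)"
      by (intro polynomial_in_y_mult P assms)
  qed (use P(3) eq in simp)
qed

lemma rational_in_y_dx:
  assumes "rational_in_y U f"
  shows "rational_in_y U (dx i f)"
    and "x \<in> U \<Longrightarrow> y \<noteq> 0 \<Longrightarrow> ((\<lambda>t. f (x + t *\<^sub>R axis i 1) y) has_field_derivative dx i f x y) (at 0)"
proof -
  show "rational_in_y U (dx i f)"
    using assms assms by (rule rational_in_y_binop) (rule polynomial_quotient_dx)
  show "x \<in> U \<Longrightarrow> y \<noteq> 0 \<Longrightarrow> ((\<lambda>t. f (x + t *\<^sub>R axis i 1) y) has_field_derivative dx i f x y) (at 0)"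
    using assms polynomial_quotient_dx(2) unfolding rational_in_y_altdef by blast
qed


section \<open>Inverse matrices\<close>

lemma pos_def_invertible: "pos_def A \<Longrightarrow> invertible A"
proof -
  assume A: "pos_def A"
  have "x = 0" if "A *v x = 0" for x
    using A that unfolding pos_def_def by (metis inner_zero_right less_irrefl)
  then show ?thesis
    by (metis invertible_left_inverse matrix_left_invertible_ker)
qed

lemma
  assumes "invertible A"
  shows matrix_inv_right: "A ** matrix_inv A = mat 1"
    and matrix_inv_left: "matrix_inv A ** A = mat 1"
  using someI_ex[OF assms[unfolded invertible_def]] unfolding matrix_inv_def by auto

text \<open>For square matrices a right inverse is two-sided, which pins down the choice made by
  \<open>matrix_inv\<close>.\<close>

lemma matrix_inv_unique:
  fixes A B :: "real ^ 'n ^ 'n"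
  shows "A ** B = mat 1 \<Longrightarrow> matrix_inv A = B"
proof -
  assume AB: "A ** B = mat 1"
  then have "matrix_inv A ** A = mat 1"
    using invertible_right_inverse matrix_inv_left by blast
  then have "matrix_inv A ** (A ** B) = B"
    by (simp add: matrix_mul_assoc)
  then show ?thesis by (simp add: AB)
qed

text \<open>Column \<open>l\<close> of the inverse solves A v = \<open>axis l 1\<close>. Cramer's
  rule makes its entries quotients of determinants, hence of polynomials in the entries of
  \<open>A\<close>.\<close>

lemma matrix_inv_cramer:
  fixes A :: "real ^ 'n ^ 'n"
  assumes "invertible A"
  shows "matrix_inv A $ j $ l = det (\<chi> i m. if m = j then axis l 1 $ i else A $ i $ m) / det A"
proof -
  have "A *v column l (matrix_inv A) = axis l 1"
    using matrix_inv_right[OF assms]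
    by (metis matrix_vector_mul_assoc matrix_vector_mul_lid matrix_vector_mult_basis)
  moreover have "det A \<noteq> 0" using assms by (simp add: invertible_det_nz)
  ultimately have "column l (matrix_inv A) = (\<chi> k. det (\<chi> i m. if m = k then axis l 1 $ i else A $ i $ m) / det A)"
    by (simp add: cramer)
  then show ?thesis by (simp add: column_def vec_eq_iff)
qed

lemma rational_in_y_matrix_inv:
  fixes A :: "real ^ 'n \<Rightarrow> real ^ 'n \<Rightarrow> real ^ 'n ^ 'n"
  assumes "open U" and A: "\<And>i j. rational_in_y U (\<lambda>x y. A x y $ i $ j)"
    and inv: "\<And>x y. x \<in> U \<Longrightarrow> y \<noteq> 0 \<Longrightarrow> invertible (A x y)"
  shows "rational_in_y U (\<lambda>x y. matrix_inv (A x y) $ j $ l)"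
proof -
  let ?B = "\<lambda>x y. \<chi> i m. if m = j then axis l 1 $ i else A x y $ i $ m"
  have "rational_in_y U (\<lambda>x y. det (?B x y))"
  proof (rule rational_in_y_det[OF assms(1)])
    show "rational_in_y U (\<lambda>x y. ?B x y $ i $ m)" for i m
      using A by (cases "m = j") (simp_all add: rational_in_y_const assms(1))
  qed
  moreover have "rational_in_y U (\<lambda>x y. det (A x y))"
    by (rule rational_in_y_det[OF assms(1) A])
  moreover have "det (A x y) \<noteq> 0" if "x \<in> U" "y \<noteq> 0" for x y
    using inv[OF that] invertible_det_nz by blast
  ultimately have "rational_in_y U (\<lambda>x y. det (?B x y) / det (A x y))"
    by (rule rational_in_y_divide)
  then show ?thesis
    by (rule rational_in_y_cong) (simp add: matrix_inv_cramer[OF inv])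
qed


section \<open>Homogeneity and Euler's identity\<close>

lemma sum_vec_nth_axis: "(\<Sum>i\<in>UNIV. y $ i *\<^sub>R axis i 1) = (y :: real ^ 'n)"
  using basis_expansion[of y] by (simp add: scalar_mult_eq_scaleR)

text \<open>Differentiate l \<mapsto> h x (l y) at l = 1 in two ways. Homogeneity for positive l
  suffices, as only l near 1 matter.\<close>

lemma euler_identity:
  assumes h: "h x differentiable (at y)"
    and hom: "\<And>l. l > 0 \<Longrightarrow> h x (l *\<^sub>R y) = l ^ k * h x y"
  shows "(\<Sum>i\<in>UNIV. y $ i * dy i h x y) = of_nat k * h x y"
proof -
  let ?D = "frechet_derivative (h x) (at y)"
  have "((\<lambda>l. h x (0 + l *\<^sub>R y)) has_field_derivative ?D y) (at 1)"
    using DERIV_along_line[of "h x" 0 1 y] h by simp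
  moreover have "eventually (\<lambda>l. h x (0 + l *\<^sub>R y) = l ^ k * h x y) (nhds 1)"
    using eventually_nhds_in_open[of "{0::real<..}" 1] by (auto elim!: eventually_mono simp: hom)
  ultimately have "((\<lambda>l. l ^ k * h x y) has_field_derivative ?D y) (at 1)"
    by (simp add: DERIV_cong_ev[OF refl _ refl])
  moreover have "((\<lambda>l. l ^ k * h x y) has_field_derivative of_nat k * h x y) (at 1)"
    by (auto intro!: derivative_eq_intros)
  ultimately have "?D y = of_nat k * h x y" by (rule DERIV_unique)
  moreover have "?D (\<Sum>i\<in>UNIV. y $ i *\<^sub>R axis i 1) = (\<Sum>i\<in>UNIV. y $ i * ?D (axis i 1))"
    using linear_frechet_derivative[OF h] by (simp add: linear_sum linear_cmul)
  ultimately show ?thesis by (simp add: sum_vec_nth_axis DERIV_dy(2)[of h, OF h])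
qed

text \<open>A fibre derivative lowers the degree by one: the increment l t at l y corresponds to the
  increment t at y, and the chain rule produces one factor l to be cancelled.\<close>

lemma dy_homogeneous:
  assumes h: "\<And>y. y \<noteq> 0 \<Longrightarrow> h x differentiable (at y)"
    and hom: "\<And>y. y \<noteq> 0 \<Longrightarrow> h x (l *\<^sub>R y) = l ^ Suc k * h x y" and l: "l > 0" and y: "y \<noteq> 0"
  shows "dy i h x (l *\<^sub>R y) = l ^ k * dy i h x y"
proof -
  have "((\<lambda>s. h x (l *\<^sub>R y + s *\<^sub>R axis i 1)) has_field_derivative dy i h x (l *\<^sub>R y)) (at (l * 0))"
    using DERIV_dy(1)[of h, OF h] l y by simp
  then have "((\<lambda>t. h x (l *\<^sub>R y + (l * t) *\<^sub>R axis i 1)) has_field_derivative dy i h x (l *\<^sub>R y) * l) (at 0)"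
    by (rule DERIV_chain2) (auto intro!: derivative_eq_intros)
  moreover have "eventually (\<lambda>t. h x (l *\<^sub>R y + (l * t) *\<^sub>R axis i 1) = l ^ Suc k * h x (y + t *\<^sub>R axis i 1)) (nhds 0)"
    using eventually_along_line[of "- {0}" y "axis i 1"] y
    by (auto elim!: eventually_mono simp: open_Compl hom[symmetric] scaleR_add_right simp del: power_Suc)
  ultimately have "((\<lambda>t. l ^ Suc k * h x (y + t *\<^sub>R axis i 1)) has_field_derivative dy i h x (l *\<^sub>R y) * l) (at 0)"
    by (simp add: DERIV_cong_ev[OF refl _ refl] del: power_Suc)
  moreover have "((\<lambda>t. l ^ Suc k * h x (y + t *\<^sub>R axis i 1)) has_field_derivative l ^ Suc k * dy i h x y) (at 0)"
    by (intro DERIV_cmult DERIV_dy(1)[of h] h y)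
  ultimately have "dy i h x (l *\<^sub>R y) * l = l ^ Suc k * dy i h x y" by (rule DERIV_unique)
  then show ?thesis using l by simp
qed

text \<open>Scaling the fibre variable commutes with moving the base point, so a base derivative
  keeps the degree.\<close>

lemma dx_homogeneous:
  assumes U: "open U" "x \<in> U" and h: "(\<lambda>(x, y). h x y) differentiable (at (x, y))"
    and hom: "\<And>x. x \<in> U \<Longrightarrow> h x (l *\<^sub>R y) = c * h x y"
  shows "dx k h x (l *\<^sub>R y) = c * dx k h x y"
proof -
  have "((\<lambda>t. c * h (x + t *\<^sub>R axis k 1) y) has_field_derivative c * dx k h x y) (at 0)"
    by (intro DERIV_cmult DERIV_dx(1) h)
  then have "((\<lambda>t. h (x + t *\<^sub>R axis k 1) (l *\<^sub>R y)) has_field_derivative c * dx k h x y) (at 0)"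
    using eventually_along_line[OF U, of "axis k 1"]
    by (subst DERIV_cong_ev[OF refl _ refl]) (auto elim!: eventually_mono simp: hom)
  then show ?thesis unfolding dx_def[of k h x "l *\<^sub>R y"] by (rule DERIV_imp_deriv)
qed


section \<open>Partial derivatives of smooth functions on the slit tangent bundle\<close>

abbreviation smooth_slit :: "(real ^ 'n::finite) set \<Rightarrow> (real ^ 'n \<Rightarrow> real ^ 'n \<Rightarrow> real) \<Rightarrow> bool" where
  "smooth_slit U h \<equiv> smooth_on (U \<times> (- {0})) (\<lambda>(x, y). h x y)"

lemma open_slit: "open U \<Longrightarrow> open (U \<times> (- {0 :: real ^ 'n}))"
  by (simp add: open_Times open_Compl)

lemma smooth_slit_differentiable:
  "smooth_slit U h \<Longrightarrow> x \<in> U \<Longrightarrow> y \<noteq> 0 \<Longrightarrow> (\<lambda>(x, y). h x y) differentiable (at (x, y))"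
  by (rule smooth_on_differentiable) auto

lemma
  assumes "smooth_slit U h" "p \<in> U \<times> (- {0})"
  shows dx_eq_frechet_derivative: "(case p of (x, y) \<Rightarrow> dx i h x y) = frechet_derivative (\<lambda>(x, y). h x y) (at p) (axis i 1, 0)"
    and dy_eq_frechet_derivative: "(case p of (x, y) \<Rightarrow> dy i h x y) = frechet_derivative (\<lambda>(x, y). h x y) (at p) (0, axis i 1)"
  using smooth_on_differentiable[OF assms]
  by (auto simp: DERIV_dx(2) DERIV_dy(2) differentiable_in_y split: prod.split)

lemma
  assumes U: "open U" and h: "smooth_slit U h"
  shows smooth_slit_dx: "smooth_slit U (dx i h)"
    and smooth_slit_dy: "smooth_slit U (dy i h)"
  using dx_eq_frechet_derivative[OF h] dy_eq_frechet_derivative[OF h]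
    smooth_on_cong[OF smooth_on_frechet_derivative[OF h] open_slit[OF U]] by metis+

text \<open>Both partial derivatives are directional derivatives of the joint function on the
  product, so the symmetry of second derivatives applies to the directions (\<open>axis k 1\<close>,
  0) and (0, \<open>axis r 1\<close>).\<close>

lemma dy_dx_commute:
  assumes U: "open U" and h: "smooth_slit U h" and x: "x \<in> U" and y: "y \<noteq> 0"
  shows "dy r (dx k h) x y = dx k (dy r h) x y"
proof -
  let ?H = "\<lambda>(x, y). h x y"
  have xy: "(x, y) \<in> U \<times> (- {0})" using x y by simp
  have "dy r (dx k h) x y = frechet_derivative (\<lambda>(x, y). dx k h x y) (at (x, y)) (0, axis r 1)"
    using dy_eq_frechet_derivative[OF smooth_slit_dx[OF U h] xy] by simp
  also have "frechet_derivative (\<lambda>(x, y). dx k h x y) (at (x, y)) =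
      frechet_derivative (\<lambda>p. frechet_derivative ?H (at p) (axis k 1, 0)) (at (x, y))"
    by (rule frechet_derivative_transform_within_open[OF
          smooth_on_differentiable[OF smooth_slit_dx[OF U h] xy] open_slit[OF U] xy dx_eq_frechet_derivative[OF h]])
  also have "\<dots> (0, axis r 1) = frechet_derivative (\<lambda>p. frechet_derivative ?H (at p) (0, axis r 1)) (at (x, y)) (axis k 1, 0)"
    by (rule frechet_derivative_commute[OF open_slit[OF U] h xy])
  also have "frechet_derivative (\<lambda>p. frechet_derivative ?H (at p) (0, axis r 1)) (at (x, y)) =
      frechet_derivative (\<lambda>(x, y). dy r h x y) (at (x, y))"
    by (rule frechet_derivative_transform_within_open[OF
          smooth_on_differentiable[OF smooth_slit_dy[OF U h] xy] open_slit[OF U] xy dy_eq_frechet_derivative[OF h], symmetric])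
  also have "\<dots> (axis k 1, 0) = dx k (dy r h) x y"
    using dx_eq_frechet_derivative[OF smooth_slit_dy[OF U h] xy] by simp
  finally show ?thesis .
qed


section \<open>The Barthel connection in one chart\<close>

text \<open>The index computation behind the spray at a fixed point: \<open>b\<close> is the inverse
  of \<open>a\<close>, \<open>L k\<close> stands for \<partial>_k log \<eta> and
  \<open>A k r s\<close> for \<partial>_k a_rs. Contracting b a to a Kronecker delta leaves y^i in
  the first term; the other two only rename indices.\<close>

lemma spray_algebra:
  fixes y L :: "'n::finite \<Rightarrow> real" and a b :: "'n \<Rightarrow> 'n \<Rightarrow> real" and A :: "'n \<Rightarrow> 'n \<Rightarrow> 'n \<Rightarrow> real"
  assumes inv: "\<And>s. (\<Sum>r\<in>UNIV. b i r * a r s) = (if i = s then 1 else 0)"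
  shows "(\<Sum>r\<in>UNIV. b i r * (\<Sum>k\<in>UNIV. \<Sum>s\<in>UNIV. y k * y s *
           ((L k * a r s + A k r s) - 1/2 * (L r * a k s + A r k s)))) =
    y i * (\<Sum>k\<in>UNIV. y k * L k) - 1/2 * (\<Sum>l\<in>UNIV. (\<Sum>r\<in>UNIV. \<Sum>s\<in>UNIV. y r * y s * a r s * b i l) * L l)
    + (\<Sum>k\<in>UNIV. \<Sum>s\<in>UNIV. \<Sum>l\<in>UNIV. y k * y s * b i l * (A k l s - 1/2 * A l k s))"
proof -
  have "(\<Sum>r\<in>UNIV. \<Sum>k\<in>UNIV. \<Sum>s\<in>UNIV. b i r * y k * y s * L k * a r s) =
      (\<Sum>k\<in>UNIV. \<Sum>s\<in>UNIV. y k * y s * L k * (\<Sum>r\<in>UNIV. b i r * a r s))"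
    by (subst sum.swap, rule sum.cong[OF refl], subst sum.swap)
      (simp add: sum_distrib_left mult_ac)
  also have "\<dots> = y i * (\<Sum>k\<in>UNIV. y k * L k)"
    unfolding inv
    by (simp add: sum_distrib_left mult_ac if_distrib[where f = "\<lambda>u. _ * u"] cong: if_cong)
  finally have 1: "(\<Sum>r\<in>UNIV. \<Sum>k\<in>UNIV. \<Sum>s\<in>UNIV. b i r * y k * y s * L k * a r s) = y i * (\<Sum>k\<in>UNIV. y k * L k)" .
  have 2: "(\<Sum>r\<in>UNIV. \<Sum>k\<in>UNIV. \<Sum>s\<in>UNIV. b i r * y k * y s * L r * a k s) =
      (\<Sum>l\<in>UNIV. (\<Sum>r\<in>UNIV. \<Sum>s\<in>UNIV. y r * y s * a r s * b i l) * L l)"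
    by (simp add: sum_distrib_left sum_distrib_right mult_ac)
  have 3: "(\<Sum>r\<in>UNIV. \<Sum>k\<in>UNIV. \<Sum>s\<in>UNIV. b i r * y k * y s * (A k r s - 1/2 * A r k s)) =
      (\<Sum>k\<in>UNIV. \<Sum>s\<in>UNIV. \<Sum>l\<in>UNIV. y k * y s * b i l * (A k l s - 1/2 * A l k s))"
    by (subst sum.swap, rule sum.cong[OF refl], subst sum.swap) (simp add: mult_ac)
  have "(\<Sum>r\<in>UNIV. b i r * (\<Sum>k\<in>UNIV. \<Sum>s\<in>UNIV. y k * y s *
           ((L k * a r s + A k r s) - 1/2 * (L r * a k s + A r k s)))) =
    (\<Sum>r\<in>UNIV. \<Sum>k\<in>UNIV. \<Sum>s\<in>UNIV. b i r * y k * y s * L k * a r s)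
    - 1/2 * (\<Sum>r\<in>UNIV. \<Sum>k\<in>UNIV. \<Sum>s\<in>UNIV. b i r * y k * y s * L r * a k s)
    + (\<Sum>r\<in>UNIV. \<Sum>k\<in>UNIV. \<Sum>s\<in>UNIV. b i r * y k * y s * (A k r s - 1/2 * A r k s))"
    unfolding sum_distrib_left sum_subtractf[symmetric] sum.distrib[symmetric]
    by (intro sum.cong refl) (simp add: algebra_simps)
  then show ?thesis by (simp only: 1 2 3)
qed

text \<open>The spray determines the covector \<open>L\<close> by inverting \<open>L \<mapsto> y (L y) - 1/2 \<alpha> b L\<close>:
  pairing with \<open>a y\<close> first isolates the scalar \<open>L y\<close>.\<close>

lemma spray_inversion:
  fixes y L R :: "'n::finite \<Rightarrow> real" and a b :: "'n \<Rightarrow> 'n \<Rightarrow> real"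
  assumes sym: "\<And>r s. a r s = a s r"
    and inv: "\<And>l m. (\<Sum>i\<in>UNIV. a l i * b i m) = (if l = m then 1 else 0)"
    and R: "\<And>i. R i = y i * (\<Sum>k\<in>UNIV. y k * L k)
      - 1/2 * (\<Sum>l\<in>UNIV. (\<Sum>r\<in>UNIV. \<Sum>s\<in>UNIV. y r * y s * a r s * b i l) * L l)"
    and \<alpha>: "\<alpha> = (\<Sum>r\<in>UNIV. \<Sum>s\<in>UNIV. y r * y s * a r s)" "\<alpha> \<noteq> 0"
  shows "L l = 2 / \<alpha> * ((\<Sum>r\<in>UNIV. a l r * y r) * (2 / \<alpha> * (\<Sum>i\<in>UNIV. \<Sum>r\<in>UNIV. a i r * y r * R i))
    - (\<Sum>i\<in>UNIV. a l i * R i))"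
proof -
  define S where "S = (\<Sum>k\<in>UNIV. y k * L k)"
  define m where "m i = (\<Sum>l\<in>UNIV. b i l * L l)" for i
  define v where "v l = (\<Sum>r\<in>UNIV. a l r * y r)" for l
  have R': "R i = y i * S - 1/2 * \<alpha> * m i" for i
  proof -
    have "(\<Sum>r\<in>UNIV. \<Sum>s\<in>UNIV. y r * y s * a r s * b i l) = \<alpha> * b i l" for l
      by (simp add: \<alpha>(1) sum_distrib_right)
    then show ?thesis unfolding R S_def m_def by (simp add: sum_distrib_left mult_ac)
  qed
  have am: "(\<Sum>i\<in>UNIV. a l i * m i) = L l" for l
  proof -
    have "(\<Sum>i\<in>UNIV. a l i * m i) = (\<Sum>k\<in>UNIV. (\<Sum>i\<in>UNIV. a l i * b i k) * L k)"
      unfolding m_def sum_distrib_left sum_distrib_right by (subst sum.swap) (simp add: mult_ac)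
    then show ?thesis by (simp add: inv if_distrib[where f = "\<lambda>u. u * _"] cong: if_cong)
  qed
  have aR: "(\<Sum>i\<in>UNIV. a l i * R i) = v l * S - 1/2 * \<alpha> * L l" for l
  proof -
    have "(\<Sum>i\<in>UNIV. a l i * R i) = S * v l - 1/2 * \<alpha> * (\<Sum>i\<in>UNIV. a l i * m i)"
      unfolding R' v_def sum_distrib_left sum_subtractf[symmetric]
      by (intro sum.cong refl) (simp add: algebra_simps)
    then show ?thesis by (simp add: am mult.commute[of S])
  qed
  have "(\<Sum>i\<in>UNIV. \<Sum>r\<in>UNIV. a i r * y r * R i) = (\<Sum>r\<in>UNIV. y r * (\<Sum>i\<in>UNIV. a r i * R i))"
    unfolding sum_distrib_left by (subst sum.swap) (simp add: sym[of _ r for r] mult_ac)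
  also have "\<dots> = S * (\<Sum>r\<in>UNIV. y r * v r) - 1/2 * \<alpha> * (\<Sum>r\<in>UNIV. y r * L r)"
    unfolding aR sum_distrib_left sum_subtractf[symmetric]
    by (intro sum.cong refl) (simp add: algebra_simps)
  also have "(\<Sum>r\<in>UNIV. y r * v r) = \<alpha>"
    unfolding v_def \<alpha>(1) by (simp add: sum_distrib_left mult_ac)
  \<comment> \<open>The first term of R contributes \<alpha> S and the second takes away half of it;
    the nonzero remainder gives the inner factor 2 / \<alpha>.\<close>
  finally have "(\<Sum>i\<in>UNIV. \<Sum>r\<in>UNIV. a i r * y r * R i) = 1/2 * \<alpha> * S"
    by (simp add: S_def[symmetric])
  then show ?thesis
    unfolding aR v_def[symmetric] using \<alpha>(2) by (simp only:) (simp add: field_simps)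
qed

lemma smooth_slit_differentiable_in_y:
  "smooth_slit U h \<Longrightarrow> x \<in> U \<Longrightarrow> y \<noteq> 0 \<Longrightarrow> h x differentiable (at y)"
  using differentiable_in_y(1)[of h x y] smooth_slit_differentiable[of U h x y] by simp

text \<open>The coordinate data of one chart; the manifold returns only in the interpretation.
  Derivatives of \<open>a\<close> are drawn from \<open>a_rational\<close>.\<close>

locale AR_chart =
  fixes U :: "(real ^ 'n::finite) set" and f \<eta> :: "real ^ 'n \<Rightarrow> real ^ 'n \<Rightarrow> real"
    and a :: "real ^ 'n \<Rightarrow> real ^ 'n \<Rightarrow> real ^ 'n ^ 'n"
  assumes open_U: "open U"
    and smooth_f: "smooth_slit U f"
    and smooth_eta: "smooth_slit U \<eta>"
    and f_homogeneous: "x \<in> U \<Longrightarrow> l > 0 \<Longrightarrow> f x (l *\<^sub>R y) = l * f x y"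
    and g_eq: "x \<in> U \<Longrightarrow> y \<noteq> 0 \<Longrightarrow> fundamental_tensor f x y = \<eta> x y *\<^sub>R a x y"
    and g_pos: "x \<in> U \<Longrightarrow> y \<noteq> 0 \<Longrightarrow> pos_def (fundamental_tensor f x y)"
    and a_transpose: "x \<in> U \<Longrightarrow> y \<noteq> 0 \<Longrightarrow> transpose (a x y) = a x y"
    and a_pos: "x \<in> U \<Longrightarrow> y \<noteq> 0 \<Longrightarrow> pos_def (a x y)"
    and a_rational: "rational_in_y U (\<lambda>x y. a x y $ i $ j)"
begin

abbreviation "E \<equiv> \<lambda>x y. (f x y)\<^sup>2"
abbreviation "L \<equiv> \<lambda>x y. ln (\<eta> x y)"
abbreviation "al \<equiv> \<lambda>i j x y. a x y $ i $ j"
abbreviation "au \<equiv> \<lambda>i j x y. matrix_inv (a x y) $ i $ j"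

lemma smooth_E: "smooth_slit U E"
  using smooth_on_mult[OF smooth_f smooth_f open_slit[OF open_U]]
  by (simp add: case_prod_unfold power2_eq_square)

text \<open>The definition only gives \<eta> \<ge> 0. Evaluating the positive definite matrices g
  and a at y forces strict positivity, which the logarithm and the division by \<eta>
  require.\<close>

lemma eta_pos:
  assumes "x \<in> U" "y \<noteq> 0"
  shows "\<eta> x y > 0"
proof -
  have "0 < y \<bullet> (fundamental_tensor f x y *v y)" "0 < y \<bullet> (a x y *v y)"
    using g_pos[OF assms] a_pos[OF assms] \<open>y \<noteq> 0\<close> by (simp_all add: pos_def_def)
  moreover have "y \<bullet> (fundamental_tensor f x y *v y) = \<eta> x y * (y \<bullet> (a x y *v y))"
    unfolding g_eq[OF assms] by (simp add: scaleR_matrix_vector_assoc[symmetric])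
  ultimately show ?thesis by (simp add: zero_less_mult_iff)
qed

lemma a_sym: "x \<in> U \<Longrightarrow> y \<noteq> 0 \<Longrightarrow> al i j x y = al j i x y"
  using arg_cong[OF a_transpose[of x y], of "\<lambda>A. A $ i $ j"] by (simp add: transpose_def)

lemma a_invertible: "x \<in> U \<Longrightarrow> y \<noteq> 0 \<Longrightarrow> invertible (a x y)"
  by (intro pos_def_invertible a_pos)

lemma au_rational: "rational_in_y U (au i j)"
  by (intro rational_in_y_matrix_inv open_U a_rational a_invertible)

lemma al_au:
  assumes "x \<in> U" "y \<noteq> 0"
  shows "(\<Sum>r\<in>UNIV. al i r x y * au r j x y) = (if i = j then 1 else 0)"
  using matrix_inv_right[OF a_invertible[OF assms]]
  by (simp add: matrix_matrix_mult_def mat_def vec_eq_iff)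

lemma au_al:
  assumes "x \<in> U" "y \<noteq> 0"
  shows "(\<Sum>r\<in>UNIV. au i r x y * al r j x y) = (if i = j then 1 else 0)"
  using matrix_inv_left[OF a_invertible[OF assms]]
  by (simp add: matrix_matrix_mult_def mat_def vec_eq_iff)

text \<open>The transposed inverse is a right inverse of the symmetric matrix, hence the
  inverse.\<close>

lemma au_sym:
  assumes "x \<in> U" "y \<noteq> 0"
  shows "au i j x y = au j i x y"
proof -
  have "a x y ** transpose (matrix_inv (a x y)) = transpose (matrix_inv (a x y) ** a x y)"
    by (simp add: matrix_transpose_mul a_transpose assms)
  also have "\<dots> = mat 1"
    by (simp add: matrix_inv_left a_invertible assms transpose_mat)
  finally have "matrix_inv (a x y) = transpose (matrix_inv (a x y))"
    by (rule matrix_inv_unique)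
  from arg_cong[OF this, of "\<lambda>A. A $ i $ j"] show ?thesis by (simp add: transpose_def)
qed

text \<open>By \<open>E_eq\<close> this is F^2 / \<eta>. Its positivity permits the divisions in the
  converse direction.\<close>

definition \<alpha> where "\<alpha> x y = (\<Sum>r\<in>UNIV. \<Sum>s\<in>UNIV. y $ r * y $ s * al r s x y)"

lemma \<alpha>_pos:
  assumes "x \<in> U" "y \<noteq> 0"
  shows "\<alpha> x y > 0"
proof -
  have "\<alpha> x y = y \<bullet> (a x y *v y)"
    by (simp add: \<alpha>_def inner_vec_def matrix_vector_mult_def sum_distrib_left mult_ac)
  then show ?thesis using a_pos[OF assms] assms(2) by (simp add: pos_def_def)
qed

lemma \<alpha>_rational: "rational_in_y U \<alpha>"
  unfolding \<alpha>_def[abs_def]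
  by (intro rational_in_y_sum rational_in_y_mult rational_in_y_coord a_rational open_U)

lemma dx_eta:
  assumes "x \<in> U" "y \<noteq> 0"
  shows "dx k \<eta> x y = \<eta> x y * dx k L x y"
proof -
  have "((\<lambda>t. ln (\<eta> (x + t *\<^sub>R axis k 1) y)) has_field_derivative inverse (\<eta> x y) * dx k \<eta> x y) (at 0)"
    using DERIV_dx(1)[OF smooth_slit_differentiable[OF smooth_eta assms]] eta_pos[OF assms]
    by (intro DERIV_chain2[where f = ln] DERIV_ln[THEN DERIV_cong]) auto
  then have "dx k L x y = inverse (\<eta> x y) * dx k \<eta> x y"
    unfolding dx_def[of k L] by (rule DERIV_imp_deriv)
  then show ?thesis using eta_pos[OF assms] by simp
qed

text \<open>Off the zero section the function is the quotient \<partial>_k \<eta> / \<eta> of smooth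
  functions with positive denominator.\<close>

lemma dx_L_differentiable:
  assumes "x \<in> U" "y \<noteq> 0"
  shows "dx k L x differentiable (at y)"
proof -
  have "(\<lambda>y. dx k \<eta> x y / \<eta> x y) differentiable (at y)"
    using eta_pos[OF assms] smooth_slit_differentiable_in_y[OF smooth_eta assms]
      smooth_slit_differentiable_in_y[OF smooth_slit_dx[OF open_U smooth_eta] assms]
    by (intro differentiable_divide) auto
  moreover have "dx k \<eta> x y / \<eta> x y = dx k L x y" if "y \<in> - {0}" for y
    using dx_eta[of x y k] eta_pos[of x y] that assms(1) by simp
  ultimately show ?thesis
    using has_derivative_transform_within_open[of "\<lambda>y. dx k \<eta> x y / \<eta> x y" _ y UNIV "- {0}" "dx k L x"] assms(2)
    unfolding differentiable_def by (auto simp: open_Compl)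
qed

section \<open>The function F^2 and its derivatives in terms of \<eta> and a\<close>

lemma g_eq_component:
  "x \<in> U \<Longrightarrow> y \<noteq> 0 \<Longrightarrow> dy r (dy s E) x y = 2 * (\<eta> x y * al r s x y)"
  using arg_cong[OF g_eq[of x y], of "\<lambda>A. A $ r $ s"] by (simp add: fundamental_tensor_def)

lemma E_homogeneous: "x \<in> U \<Longrightarrow> l > 0 \<Longrightarrow> E x (l *\<^sub>R y) = l ^ 2 * E x y"
  by (simp add: f_homogeneous power_mult_distrib)

lemma smooth_dy_E: "smooth_slit U (dy r E)" and smooth_dx_E: "smooth_slit U (dx r E)"
  by (rule smooth_slit_dy smooth_slit_dx, rule open_U, rule smooth_E)+

lemmas E_differentiable = smooth_slit_differentiable_in_y[OF smooth_E]
  and dy_E_differentiable = smooth_slit_differentiable_in_y[OF smooth_dy_E]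
  and dx_E_differentiable = smooth_slit_differentiable_in_y[OF smooth_dx_E]

lemma dy_E_homogeneous: "x \<in> U \<Longrightarrow> y \<noteq> 0 \<Longrightarrow> l > 0 \<Longrightarrow> dy r E x (l *\<^sub>R y) = l ^ 1 * dy r E x y"
  by (rule dy_homogeneous) (use E_differentiable E_homogeneous in \<open>auto simp: power2_eq_square\<close>)

lemma dx_E_homogeneous: "x \<in> U \<Longrightarrow> y \<noteq> 0 \<Longrightarrow> l > 0 \<Longrightarrow> dx k E x (l *\<^sub>R y) = l ^ 2 * dx k E x y"
  by (rule dx_homogeneous[OF open_U]) (use smooth_slit_differentiable[OF smooth_E] E_homogeneous in auto)

lemma dy_E:
  assumes "x \<in> U" "y \<noteq> 0"
  shows "dy r E x y = 2 * (\<Sum>s\<in>UNIV. y $ s * (\<eta> x y * al r s x y))"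
proof -
  \<comment> \<open>The degree of \<open>dy r E\<close> is 1. Euler's sum produces entries
    \<open>al s r\<close>, which symmetry turns into \<open>al r s\<close>.\<close>
  have "of_nat 1 * dy r E x y = (\<Sum>s\<in>UNIV. y $ s * dy s (dy r E) x y)"
    using assms by (intro euler_identity[symmetric] dy_E_differentiable dy_E_homogeneous)
  then show ?thesis
    using assms by (simp add: g_eq_component a_sym[of x y _ r] sum_distrib_left mult_ac)
qed

lemma E_eq:
  assumes "x \<in> U" "y \<noteq> 0"
  shows "E x y = (\<Sum>r\<in>UNIV. \<Sum>s\<in>UNIV. y $ r * y $ s * (\<eta> x y * al r s x y))"
proof -
  have "of_nat 2 * E x y = (\<Sum>r\<in>UNIV. y $ r * dy r E x y)"
    using assms by (intro euler_identity[symmetric] E_differentiable E_homogeneous)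
  also have "\<dots> = 2 * (\<Sum>r\<in>UNIV. \<Sum>s\<in>UNIV. y $ r * y $ s * (\<eta> x y * al r s x y))"
    using assms by (simp add: dy_E sum_distrib_left mult_ac)
  finally show ?thesis by simp
qed

text \<open>Written with \<partial>_k \<eta> = \<eta> \<partial>_k log \<eta>, so that \<eta>
  factors out and later cancels against the inverse of g.\<close>

lemma DERIV_eta_a:
  assumes "x \<in> U" "y \<noteq> 0"
  shows "((\<lambda>t. \<eta> (x + t *\<^sub>R axis k 1) y * al r s (x + t *\<^sub>R axis k 1) y) has_field_derivative
    \<eta> x y * (dx k L x y * al r s x y + dx k (al r s) x y)) (at 0)"
  using DERIV_mult[OF DERIV_dx(1)[OF smooth_slit_differentiable[OF smooth_eta assms]]
      rational_in_y_dx(2)[OF a_rational assms], of k k r s] dx_eta[OF assms, of k]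
  by (simp add: algebra_simps)

lemma dx_dy_E:
  assumes "x \<in> U" "y \<noteq> 0"
  shows "dx k (dy r E) x y = 2 * (\<Sum>s\<in>UNIV. y $ s * (\<eta> x y * (dx k L x y * al r s x y + dx k (al r s) x y)))"
proof -
  have "dx k (dy r E) x y = dx k (\<lambda>x y. 2 * (\<Sum>s\<in>UNIV. y $ s * (\<eta> x y * al r s x y))) x y"
    using assms dy_E by (intro dx_cong[OF open_U]) auto
  also have "\<dots> = 2 * (\<Sum>s\<in>UNIV. y $ s * (\<eta> x y * (dx k L x y * al r s x y + dx k (al r s) x y)))"
    unfolding dx_def[of k "\<lambda>x y. 2 * (\<Sum>s\<in>UNIV. y $ s * (\<eta> x y * al r s x y))"]
    by (intro DERIV_imp_deriv DERIV_cmult DERIV_sum DERIV_eta_a assms)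
  finally show ?thesis .
qed

lemma dx_E:
  assumes "x \<in> U" "y \<noteq> 0"
  shows "dx k E x y = (\<Sum>r\<in>UNIV. \<Sum>s\<in>UNIV. y $ r * y $ s * (\<eta> x y * (dx k L x y * al r s x y + dx k (al r s) x y)))"
proof -
  have "dx k E x y = dx k (\<lambda>x y. \<Sum>r\<in>UNIV. \<Sum>s\<in>UNIV. y $ r * y $ s * (\<eta> x y * al r s x y)) x y"
    using assms E_eq by (intro dx_cong[OF open_U]) auto
  also have "\<dots> = (\<Sum>r\<in>UNIV. \<Sum>s\<in>UNIV. y $ r * y $ s * (\<eta> x y * (dx k L x y * al r s x y + dx k (al r s) x y)))"
    unfolding dx_def[of k "\<lambda>x y. \<Sum>r\<in>UNIV. \<Sum>s\<in>UNIV. y $ r * y $ s * (\<eta> x y * al r s x y)"]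
    by (intro DERIV_imp_deriv DERIV_cmult DERIV_sum DERIV_eta_a assms)
  finally show ?thesis .
qed

section \<open>The spray\<close>

lemma matrix_inv_g:
  assumes "x \<in> U" "y \<noteq> 0"
  shows "matrix_inv (fundamental_tensor f x y) $ i $ r = au i r x y / \<eta> x y"
proof -
  have "(\<eta> x y *\<^sub>R a x y) ** ((1 / \<eta> x y) *\<^sub>R matrix_inv (a x y)) = mat 1"
    using eta_pos[OF assms] by (simp add: vec_eq_iff matrix_matrix_mult_def mat_def al_au[OF assms])
  then show ?thesis by (simp add: g_eq[OF assms] matrix_inv_unique)
qed

text \<open>The contraction with y^k y^s of the formal Christoffel symbols of \<open>a\<close>, with
  base derivatives only. The order \<open>au l j\<close> is that of the final formula, whereas the
  spray itself produces \<open>au j l\<close>.\<close>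

definition residual_spray where
  "residual_spray j x y = (\<Sum>k\<in>UNIV. \<Sum>s\<in>UNIV. \<Sum>l\<in>UNIV. y $ k * y $ s * au l j x y *
     (dx k (al l s) x y - 1/2 * dx l (al k s) x y))"

lemma residual_spray_rational: "rational_in_y U (residual_spray j)"
  unfolding residual_spray_def[abs_def]
  by (intro rational_in_y_sum rational_in_y_mult rational_in_y_diff rational_in_y_coord rational_in_y_const
      rational_in_y_dx au_rational a_rational open_U)

lemma spray_eq:
  assumes "x \<in> U" "y \<noteq> 0"
  shows "spray_coeff f i x y = 1/2 * (y $ i * (\<Sum>k\<in>UNIV. y $ k * dx k L x y)
    - 1/2 * (\<Sum>l\<in>UNIV. (\<Sum>r\<in>UNIV. \<Sum>s\<in>UNIV. y $ r * y $ s * al r s x y * au i l x y) * dx l L x y)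
    + residual_spray i x y)"
proof -
  have *: "(\<Sum>k\<in>UNIV. y $ k * dy r (dx k E) x y) - dx r E x y =
      2 * \<eta> x y * (\<Sum>k\<in>UNIV. \<Sum>s\<in>UNIV. y $ k * y $ s *
        ((dx k L x y * al r s x y + dx k (al r s) x y)
         - 1/2 * (dx r L x y * al k s x y + dx r (al k s) x y)))" for r
    \<comment> \<open>After the interchange, the base derivative acts on the closed form of
      \<open>dy r E\<close>.\<close>
    unfolding dy_dx_commute[OF open_U smooth_E assms] dx_dy_E[OF assms] dx_E[OF assms]
      sum_distrib_left sum_subtractf[symmetric]
    by (intro sum.cong refl) (simp add: algebra_simps)
  have "spray_coeff f i x y = 1/2 * (\<Sum>r\<in>UNIV. au i r x y * (\<Sum>k\<in>UNIV. \<Sum>s\<in>UNIV. y $ k * y $ s *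
        ((dx k L x y * al r s x y + dx k (al r s) x y)
         - 1/2 * (dx r L x y * al k s x y + dx r (al k s) x y))))"
    unfolding spray_coeff_def matrix_inv_g[OF assms] * sum_distrib_left
    using eta_pos[OF assms] by (intro sum.cong refl) simp
  also have "\<dots> = 1/2 * (y $ i * (\<Sum>k\<in>UNIV. y $ k * dx k L x y)
    - 1/2 * (\<Sum>l\<in>UNIV. (\<Sum>r\<in>UNIV. \<Sum>s\<in>UNIV. y $ r * y $ s * al r s x y * au i l x y) * dx l L x y)
    + (\<Sum>k\<in>UNIV. \<Sum>s\<in>UNIV. \<Sum>l\<in>UNIV. y $ k * y $ s * au i l x y *
     (dx k (al l s) x y - 1/2 * dx l (al k s) x y)))"
    by (subst spray_algebra) (rule au_al[OF assms], rule refl)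
  finally show ?thesis
    by (simp add: residual_spray_def au_sym[OF assms, of i])
qed

text \<open>Derived from the definition, where everything is a derivative of the homogeneous
  function F^2: g has degree 0 and the bracket degree 2. The individual terms of
  \<open>spray_eq\<close> need not be homogeneous.\<close>

lemma spray_homogeneous:
  assumes "x \<in> U" "y \<noteq> 0" "l > 0"
  shows "spray_coeff f i x (l *\<^sub>R y) = l ^ 2 * spray_coeff f i x y"
proof -
  have g: "fundamental_tensor f x (l *\<^sub>R y) = fundamental_tensor f x y"
  proof -
    have "dy i (dy j E) x (l *\<^sub>R y) = l ^ 0 * dy i (dy j E) x y" for i j
      using assms dy_E_differentiable dy_E_homogeneous by (intro dy_homogeneous[of "dy j E"]) auto
    then show ?thesis by (simp add: fundamental_tensor_def)
  qed
  have d: "dy r (dx k E) x (l *\<^sub>R y) = l ^ 1 * dy r (dx k E) x y" for r k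
    using assms dx_E_differentiable dx_E_homogeneous by (intro dy_homogeneous[of "dx k E"]) (auto simp: power2_eq_square)
  have "(\<Sum>k\<in>UNIV. (l *\<^sub>R y) $ k * dy r (dx k E) x (l *\<^sub>R y)) - dx r E x (l *\<^sub>R y) =
      l ^ 2 * ((\<Sum>k\<in>UNIV. y $ k * dy r (dx k E) x y) - dx r E x y)" for r
    unfolding d dx_E_homogeneous[OF assms]
    by (simp add: sum_distrib_left right_diff_distrib power2_eq_square mult_ac)
  then show ?thesis
    by (simp add: spray_coeff_def g sum_distrib_left mult_ac)
qed

text \<open>Euler's identity for the spray requires this; it is read off \<open>spray_eq\<close>,
  where every factor is differentiable along the fibre.\<close>

lemma spray_differentiable:
  assumes "x \<in> U" "y \<noteq> 0"
  shows "spray_coeff f i x differentiable (at y)"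
proof -
  let ?G = "\<lambda>y. 1/2 * (y $ i * (\<Sum>k\<in>UNIV. y $ k * dx k L x y)
    - 1/2 * (\<Sum>l\<in>UNIV. (\<Sum>r\<in>UNIV. \<Sum>s\<in>UNIV. y $ r * y $ s * al r s x y * au i l x y) * dx l L x y)
    + residual_spray i x y)"
  have "?G differentiable (at y)"
    using assms dx_L_differentiable[OF assms] rational_in_y_differentiable[OF a_rational assms]
      rational_in_y_differentiable[OF au_rational assms] rational_in_y_differentiable[OF residual_spray_rational assms]
    by (intro differentiable_mult differentiable_add differentiable_diff differentiable_sum) auto
  then show ?thesis
    using has_derivative_transform_within_open[of ?G _ y UNIV "- {0}" "spray_coeff f i x"] assms
    unfolding differentiable_def by (auto simp: open_Compl spray_eq)
qed

lemma spray_eq_barthel: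
  assumes "x \<in> U" "y \<noteq> 0"
  shows "spray_coeff f i x y = 1/2 * (\<Sum>j\<in>UNIV. y $ j * barthel f i j x y)"
proof -
  have "(\<Sum>j\<in>UNIV. y $ j * dy j (spray_coeff f i) x y) = of_nat 2 * spray_coeff f i x y"
    using assms by (intro euler_identity spray_differentiable spray_homogeneous)
  then show ?thesis by (simp add: barthel_def)
qed

section \<open>The Barthel connection: formula and rationality\<close>

lemma barthel_formula:
  assumes "x \<in> U" "y \<noteq> 0"
  shows "barthel f j i x y =
     1/2 * (y $ j * dx i L x y + (if j = i then 1 else 0) * (\<Sum>k\<in>UNIV. y $ k * dx k L x y))
     - 1/4 * (\<Sum>l\<in>UNIV. \<Sum>r\<in>UNIV. y $ r *
         (2 * al i r x y * au j l x y +
          (\<Sum>s\<in>UNIV. y $ s * (au j l x y * dy i (al r s) x y + al r s x y * dy i (au j l) x y)))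
         * dx l L x y)
     + 1/2 * (\<Sum>l\<in>UNIV.
         (y $ j * y $ l - 1/2 * (\<Sum>r\<in>UNIV. \<Sum>s\<in>UNIV. y $ r * y $ s * al r s x y * au j l x y))
         * dy i (dx l L) x y)
     + 1/2 * dy i (residual_spray j) x y"
proof -
  let ?d = "\<lambda>k. if k = i then 1 else (0::real)"
  let ?q = "\<lambda>l. \<Sum>r\<in>UNIV. \<Sum>s\<in>UNIV. y $ r * y $ s * al r s x y * au j l x y"
  let ?p = "\<lambda>l. \<Sum>r\<in>UNIV. y $ r * (2 * al i r x y * au j l x y +
          (\<Sum>s\<in>UNIV. y $ s * (au j l x y * dy i (al r s) x y + al r s x y * dy i (au j l) x y)))"
  have y: "((\<lambda>t. (y + t *\<^sub>R axis i 1) $ k) has_field_derivative ?d k) (at 0)" for k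
    by (auto intro!: derivative_eq_intros simp: axis_def)
  have L: "((\<lambda>t. dx k L x (y + t *\<^sub>R axis i 1)) has_field_derivative dy i (dx k L) x y) (at 0)" for k
    by (rule DERIV_dy(1)[of "dx k L", OF dx_L_differentiable[OF assms]])
  have a: "((\<lambda>t. al r s x (y + t *\<^sub>R axis i 1)) has_field_derivative dy i (al r s) x y) (at 0)" for r s
    by (rule DERIV_dy(1)[of "al r s", OF rational_in_y_differentiable[OF a_rational assms]])
  have b: "((\<lambda>t. au r s x (y + t *\<^sub>R axis i 1)) has_field_derivative dy i (au r s) x y) (at 0)" for r s
    by (rule DERIV_dy(1)[of "au r s", OF rational_in_y_differentiable[OF au_rational assms]])
  have T: "((\<lambda>t. residual_spray j x (y + t *\<^sub>R axis i 1)) has_field_derivative dy i (residual_spray j) x y) (at 0)"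
    by (rule DERIV_dy(1)[of "residual_spray j", OF rational_in_y_differentiable[OF residual_spray_rational assms]])
  have 1: "((\<lambda>t. (y + t *\<^sub>R axis i 1) $ j * (\<Sum>k\<in>UNIV. (y + t *\<^sub>R axis i 1) $ k * dx k L x (y + t *\<^sub>R axis i 1)))
      has_field_derivative y $ j * dx i L x y + ?d j * (\<Sum>k\<in>UNIV. y $ k * dx k L x y)
        + (\<Sum>l\<in>UNIV. y $ j * y $ l * dy i (dx l L) x y)) (at 0)"
  proof -
    have "((\<lambda>t. \<Sum>k\<in>UNIV. (y + t *\<^sub>R axis i 1) $ k * dx k L x (y + t *\<^sub>R axis i 1)) has_field_derivative
        (\<Sum>k\<in>UNIV. ?d k * dx k L x y + y $ k * dy i (dx k L) x y)) (at 0)"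
      by (intro DERIV_sum) (rule DERIV_cong[OF DERIV_mult[OF y L]], simp)
    from DERIV_mult[OF y[of j] this] show ?thesis
      by (rule DERIV_cong)
        (simp add: sum.distrib distrib_left sum_distrib_left mult_ac mult_delta_left mult_delta_right)
  qed
  have q: "((\<lambda>t. \<Sum>r\<in>UNIV. \<Sum>s\<in>UNIV. (y + t *\<^sub>R axis i 1) $ r * (y + t *\<^sub>R axis i 1) $ s *
      al r s x (y + t *\<^sub>R axis i 1) * au j l x (y + t *\<^sub>R axis i 1)) has_field_derivative ?p l) (at 0)" for l
  proof (rule DERIV_cong)
    show "((\<lambda>t. \<Sum>r\<in>UNIV. \<Sum>s\<in>UNIV. (y + t *\<^sub>R axis i 1) $ r * (y + t *\<^sub>R axis i 1) $ s *
      al r s x (y + t *\<^sub>R axis i 1) * au j l x (y + t *\<^sub>R axis i 1)) has_field_derivative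
      (\<Sum>r\<in>UNIV. \<Sum>s\<in>UNIV. ?d r * (y $ s * al r s x y * au j l x y) + ?d s * (y $ r * al r s x y * au j l x y)
        + y $ r * (y $ s * (au j l x y * dy i (al r s) x y + al r s x y * dy i (au j l) x y)))) (at 0)"
      by (intro DERIV_sum) (rule DERIV_cong[OF DERIV_mult[OF DERIV_mult[OF DERIV_mult[OF y y] a] b]], simp add: algebra_simps)
    \<comment> \<open>Differentiating y^r and y^s gives two Kronecker sums that coincide by symmetry
      of \<open>a\<close>; this is the factor 2 in \<open>?p\<close>.\<close>
    have "(\<Sum>r\<in>UNIV. \<Sum>s\<in>UNIV. ?d r * (y $ s * al r s x y * au j l x y)) = (\<Sum>s\<in>UNIV. y $ s * al i s x y * au j l x y)"
      by (subst sum.swap) (simp add: if_distrib[where f = "\<lambda>u. u * _"] cong: if_cong)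
    moreover have "(\<Sum>r\<in>UNIV. \<Sum>s\<in>UNIV. ?d s * (y $ r * al r s x y * au j l x y)) = (\<Sum>r\<in>UNIV. y $ r * al i r x y * au j l x y)"
      by (simp add: a_sym[OF assms, of _ i] if_distrib[where f = "\<lambda>u. u * _"] cong: if_cong)
    ultimately show "(\<Sum>r\<in>UNIV. \<Sum>s\<in>UNIV. ?d r * (y $ s * al r s x y * au j l x y) + ?d s * (y $ r * al r s x y * au j l x y)
        + y $ r * (y $ s * (au j l x y * dy i (al r s) x y + al r s x y * dy i (au j l) x y))) = ?p l"
      by (simp add: sum.distrib distrib_left sum_distrib_left mult_ac)
  qed
  have 2: "((\<lambda>t. \<Sum>l\<in>UNIV. (\<Sum>r\<in>UNIV. \<Sum>s\<in>UNIV. (y + t *\<^sub>R axis i 1) $ r * (y + t *\<^sub>R axis i 1) $ s *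
      al r s x (y + t *\<^sub>R axis i 1) * au j l x (y + t *\<^sub>R axis i 1)) * dx l L x (y + t *\<^sub>R axis i 1))
      has_field_derivative (\<Sum>l\<in>UNIV. ?p l * dx l L x y + ?q l * dy i (dx l L) x y)) (at 0)"
    by (intro DERIV_sum) (rule DERIV_cong[OF DERIV_mult[OF q L]], simp)
  let ?G = "\<lambda>x y. 1/2 * (y $ j * (\<Sum>k\<in>UNIV. y $ k * dx k L x y)
    - 1/2 * (\<Sum>l\<in>UNIV. (\<Sum>r\<in>UNIV. \<Sum>s\<in>UNIV. y $ r * y $ s * al r s x y * au j l x y) * dx l L x y)
    + residual_spray j x y)"
  have "barthel f j i x y = dy i ?G x y"
    unfolding barthel_def using assms by (intro dy_cong spray_eq)
  also have "\<dots> = 1/2 * (y $ j * dx i L x y + ?d j * (\<Sum>k\<in>UNIV. y $ k * dx k L x y)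
        + (\<Sum>l\<in>UNIV. y $ j * y $ l * dy i (dx l L) x y)
        - 1/2 * (\<Sum>l\<in>UNIV. ?p l * dx l L x y + ?q l * dy i (dx l L) x y)
        + dy i (residual_spray j) x y)"
    unfolding dy_def[of i ?G] by (intro DERIV_imp_deriv DERIV_cmult DERIV_add DERIV_diff 1 2 T)
  \<comment> \<open>The 1/4 is the overall 1/2 of the spray times the 1/2 of its \<alpha> term; the
    fibre derivatives of \<partial>_l log \<eta> from both product rules are collected in one
    sum.\<close>
  also have "\<dots> = 1/2 * (y $ j * dx i L x y + ?d j * (\<Sum>k\<in>UNIV. y $ k * dx k L x y))
     - 1/4 * (\<Sum>l\<in>UNIV. ?p l * dx l L x y)
     + 1/2 * (\<Sum>l\<in>UNIV. (y $ j * y $ l - 1/2 * ?q l) * dy i (dx l L) x y)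
     + 1/2 * dy i (residual_spray j) x y"
    by (simp add: sum.distrib sum_subtractf left_diff_distrib sum_distrib_left algebra_simps)
  finally show ?thesis by (simp only: sum_distrib_right)
qed

lemma barthel_rational_iff:
  "(\<forall>i j. rational_in_y U (barthel f i j)) \<longleftrightarrow> (\<forall>k. rational_in_y U (dx k L))"
proof
  assume L: "\<forall>k. rational_in_y U (dx k L)"
  \<comment> \<open>The spray involves the \<partial>_k log \<eta> without fibre derivatives, and
    rationality is stable under \<open>dy\<close>.\<close>
  have "rational_in_y U (spray_coeff f i)" for i
  proof (rule rational_in_y_cong[OF _ spray_eq[symmetric]])
    show "rational_in_y U (\<lambda>x y. 1/2 * (y $ i * (\<Sum>k\<in>UNIV. y $ k * dx k L x y)
      - 1/2 * (\<Sum>l\<in>UNIV. (\<Sum>r\<in>UNIV. \<Sum>s\<in>UNIV. y $ r * y $ s * al r s x y * au i l x y) * dx l L x y)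
      + residual_spray i x y))"
      by (intro rational_in_y_mult rational_in_y_add rational_in_y_diff rational_in_y_sum rational_in_y_const
          rational_in_y_coord a_rational au_rational residual_spray_rational L[rule_format] open_U)
  qed
  then show "\<forall>i j. rational_in_y U (barthel f i j)"
    unfolding barthel_def by (intro allI rational_in_y_dy)
next
  assume N: "\<forall>i j. rational_in_y U (barthel f i j)"
  \<comment> \<open>By \<open>spray_eq_barthel\<close> the sum is twice the spray, so
    \<open>R\<close> is the part of it that carries \<partial>_k log \<eta>, here visibly
    rational.\<close>
  define R where "R i x y = (\<Sum>j\<in>UNIV. y $ j * barthel f i j x y) - residual_spray i x y" for i x y
  have R_rational: "rational_in_y U (R i)" for i
    unfolding R_def[abs_def]
    by (intro rational_in_y_diff rational_in_y_sum rational_in_y_mult rational_in_y_coord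
        residual_spray_rational N[rule_format] open_U)
  have R: "R i x y = y $ i * (\<Sum>k\<in>UNIV. y $ k * dx k L x y)
      - 1/2 * (\<Sum>l\<in>UNIV. (\<Sum>r\<in>UNIV. \<Sum>s\<in>UNIV. y $ r * y $ s * al r s x y * au i l x y) * dx l L x y)"
    if "x \<in> U" "y \<noteq> 0" for i x y
    using spray_eq[OF that, of i] spray_eq_barthel[OF that, of i] unfolding R_def by argo
  show "\<forall>k. rational_in_y U (dx k L)"
  proof (rule allI, rule rational_in_y_cong)
    fix k
    \<comment> \<open>The expression that \<open>spray_inversion\<close> yields at each point;
      \<alpha> > 0 makes it an honest quotient off the zero section.\<close>
    show "rational_in_y U (\<lambda>x y. 2 / \<alpha> x y * ((\<Sum>r\<in>UNIV. al k r x y * y $ r) *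
        (2 / \<alpha> x y * (\<Sum>i\<in>UNIV. \<Sum>r\<in>UNIV. al i r x y * y $ r * R i x y)) - (\<Sum>i\<in>UNIV. al k i x y * R i x y)))"
      using \<alpha>_pos
      by (intro rational_in_y_mult rational_in_y_diff rational_in_y_sum rational_in_y_divide rational_in_y_const
          rational_in_y_coord a_rational R_rational \<alpha>_rational open_U) (metis less_irrefl)+
    fix x y assume xy: "x \<in> U" "y \<noteq> (0 :: real ^ 'n)"
    show "2 / \<alpha> x y * ((\<Sum>r\<in>UNIV. al k r x y * y $ r) *
        (2 / \<alpha> x y * (\<Sum>i\<in>UNIV. \<Sum>r\<in>UNIV. al i r x y * y $ r * R i x y)) - (\<Sum>i\<in>UNIV. al k i x y * R i x y)) = dx k L x y"
      using \<alpha>_pos[OF xy]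
      by (intro spray_inversion[where b = "\<lambda>i j. au i j x y" and L = "\<lambda>k. dx k L x y", symmetric]
          a_sym[OF xy] al_au[OF xy] R[OF xy] \<alpha>_def) simp
  qed
qed

end


section \<open>Tangent vectors in a chart\<close>

context
  fixes M :: "'m topology" and \<A> :: "('m, 'n::finite) chart set"
  assumes M: "smooth_manifold M \<A>"
begin

lemma chart_homeomorphic:
  assumes "c \<in> \<A>"
  shows "homeomorphic_map (subtopology M (fst c)) (top_of_set (chart_image c)) (snd c)"
    and "openin M (fst c)" and "open (chart_image c)"
  using M assms unfolding smooth_manifold_def chart_of_def by blast+

lemma chart_inj:
  assumes "c \<in> \<A>"
  shows "inj_on (snd c) (fst c)"
  using homeomorphic_imp_injective_map[OF chart_homeomorphic(1)[OF assms]]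
    openin_subset[OF chart_homeomorphic(2)[OF assms]]
  by (simp add: inf_absorb2)

lemma open_chart_overlap:
  assumes "c \<in> \<A>" "d \<in> \<A>"
  shows "open (snd c ` (fst c \<inter> fst d))"
proof -
  have "openin (subtopology M (fst c)) (fst c \<inter> fst d)"
    using chart_homeomorphic(2) assms by (simp add: openin_subtopology_Int2)
  then have "openin (top_of_set (chart_image c)) (snd c ` (fst c \<inter> fst d))"
    using homeomorphic_imp_open_map[OF chart_homeomorphic(1)[OF assms(1)]] by (simp add: open_map_def)
  then show ?thesis
    using chart_homeomorphic(3)[OF assms(1)] by (simp add: openin_open_eq)
qed

lemma transition_chart: "c \<in> \<A> \<Longrightarrow> p \<in> fst c \<Longrightarrow> transition c d (snd c p) = snd d p"
  by (simp add: transition_def chart_inj)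

lemma transition_differentiable:
  assumes "c \<in> \<A>" "d \<in> \<A>" "p \<in> fst c" "p \<in> fst d"
  shows "transition c d differentiable (at (snd c p))"
proof (rule smooth_on_differentiable)
  show "smooth_on (snd c ` (fst c \<inter> fst d)) (transition c d)"
    using M assms unfolding smooth_manifold_def by blast
qed (use assms in blast)

text \<open>\<open>transition c c\<close> is known to be the identity only on the chart image;
  openness of that image carries this over to the derivative.\<close>

lemma frechet_derivative_transition_self:
  assumes "c \<in> \<A>" "p \<in> fst c"
  shows "frechet_derivative (transition c c) (at (snd c p)) = (\<lambda>v. v)"
proof -
  have "frechet_derivative (transition c c) (at (snd c p)) = frechet_derivative (\<lambda>z. z) (at (snd c p))"
    using assms open_chart_overlap[of c c]
    by (intro frechet_derivative_transform_within_open[where X = "snd c ` (fst c \<inter> fst c)"])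
      (auto simp: transition_differentiable transition_chart)
  then show ?thesis by simp
qed

text \<open>The cocycle rule, which makes the transformation law of tangent vectors
  consistent.\<close>

lemma frechet_derivative_transition_compose:
  assumes "c \<in> \<A>" "d \<in> \<A>" "e \<in> \<A>" "p \<in> fst c" "p \<in> fst d" "p \<in> fst e"
  shows "frechet_derivative (transition c e) (at (snd c p)) v =
    frechet_derivative (transition d e) (at (snd d p)) (frechet_derivative (transition c d) (at (snd c p)) v)"
proof -
  \<comment> \<open>By injectivity of \<open>snd c\<close> this is the image of the triple overlap,
    where the transition maps compose exactly.\<close>
  let ?X = "snd c ` (fst c \<inter> fst d) \<inter> snd c ` (fst c \<inter> fst e)"
  have d: "transition c d differentiable (at (snd c p))"
    and e: "transition d e differentiable (at (transition c d (snd c p)))"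
    using assms by (auto simp: transition_differentiable transition_chart)
  have "frechet_derivative (transition c e) (at (snd c p)) =
      frechet_derivative (transition d e \<circ> transition c d) (at (snd c p))"
  proof (rule frechet_derivative_transform_within_open[where X = ?X])
    show "transition c e z = (transition d e \<circ> transition c d) z" if z: "z \<in> ?X" for z
    proof -
      obtain q where "z = snd c q" "q \<in> fst c" "q \<in> fst d" "q \<in> fst e"
        using z inj_onD[OF chart_inj[OF assms(1)]] by blast
      then show ?thesis using assms by (simp add: transition_chart)
    qed
  qed (use assms in \<open>auto intro: open_chart_overlap transition_differentiable\<close>)
  then show ?thesis
    using frechet_derivative_compose[OF d e] assms by (simp add: transition_chart)
qed

text \<open>Push \<open>y\<close> forward from \<open>c\<close> to every chart around
  \<open>p\<close>: the cocycle rule gives the transformation law, and the transition from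
  \<open>c\<close> to itself returns \<open>y\<close>.\<close>

lemma exists_tangent_vector:
  assumes c: "c \<in> \<A>" "p \<in> fst c"
  obtains v where "tangent_vector \<A> p v" "v c = y"
proof
  define v where
    "v e = (if e \<in> \<A> \<and> p \<in> fst e then frechet_derivative (transition c e) (at (snd c p)) y else 0)" for e
  have "v e = frechet_derivative (transition d e) (at (snd d p)) (v d)"
    if "d \<in> \<A>" "e \<in> \<A>" "p \<in> fst d" "p \<in> fst e" for d e
    unfolding v_def
    using frechet_derivative_transition_compose[OF c(1) that(1,2) c(2) that(3,4)] that by (simp only: simp_thms if_True)
  moreover have "v e = 0" if "\<not> (e \<in> \<A> \<and> p \<in> fst e)" for e
    using that unfolding v_def by (rule if_not_P)
  ultimately show "tangent_vector \<A> p v"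
    unfolding tangent_vector_def by blast
  show "v c = y" using c by (simp add: v_def frechet_derivative_transition_self)
qed

text \<open>\<open>in_coords\<close> selects a preimage with \<open>inv_into\<close>, which is
  meaningful because every (x, y) over the chart image is attained.\<close>

lemma induced_coords_inverse:
  assumes "c \<in> \<A>" "x \<in> chart_image c"
  obtains p v where "inv_into {(p, v) \<in> tangent_bundle M \<A>. p \<in> fst c} (induced_coords c) (x, y) = (p, v)"
    "(p, v) \<in> tangent_bundle M \<A>" "p \<in> fst c" "snd c p = x" "v c = y"
proof -
  let ?S = "{(p, v) \<in> tangent_bundle M \<A>. p \<in> fst c}"
  obtain p where p: "p \<in> fst c" "snd c p = x"
    using assms(2) unfolding chart_image_def by blast
  obtain v where v: "tangent_vector \<A> p v" "v c = y"
    using exists_tangent_vector[OF assms(1) p(1)] .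
  have "p \<in> topspace M"
    using openin_subset[OF chart_homeomorphic(2)[OF assms(1)]] p(1) by blast
  then have "(p, v) \<in> ?S" using p v by (simp add: tangent_bundle_def)
  moreover have "(x, y) = induced_coords c (p, v)"
    using p v by (simp add: induced_coords_def)
  ultimately have im: "(x, y) \<in> induced_coords c ` ?S" by (rule rev_image_eqI)
  obtain p' v' where u: "inv_into ?S (induced_coords c) (x, y) = (p', v')"
    by (cases "inv_into ?S (induced_coords c) (x, y)")
  have "(p', v') \<in> ?S" using inv_into_into[OF im] unfolding u .
  moreover have "induced_coords c (p', v') = (x, y)" using f_inv_into_f[OF im] unfolding u .
  ultimately show thesis using that[OF u] by (simp add: induced_coords_def)
qed

text \<open>The hypothesis scales a tangent vector in all charts at once, the conclusion only its
  components in \<open>c\<close>. Linearity of the derivatives of transition maps identifies the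
  vector over (x, l y) with l times the one over (x, y).\<close>

lemma in_coords_homogeneous:
  assumes F: "\<And>p v l. (p, v) \<in> tangent_bundle M \<A> \<Longrightarrow> l > 0 \<Longrightarrow> F (p, \<lambda>c. l *\<^sub>R v c) = l * F (p, v)"
    and c: "c \<in> \<A>" "x \<in> chart_image c" and l: "l > 0"
  shows "in_coords M \<A> c F x (l *\<^sub>R y) = l * in_coords M \<A> c F x y"
proof -
  let ?u = "inv_into {(p, v) \<in> tangent_bundle M \<A>. p \<in> fst c} (induced_coords c)"
  obtain p v where v: "?u (x, y) = (p, v)" "(p, v) \<in> tangent_bundle M \<A>" "p \<in> fst c" "snd c p = x" "v c = y"
    using induced_coords_inverse[OF c] .
  obtain p' v' where v': "?u (x, l *\<^sub>R y) = (p', v')" "(p', v') \<in> tangent_bundle M \<A>" "p' \<in> fst c"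
      "snd c p' = x" "v' c = l *\<^sub>R y"
    using induced_coords_inverse[OF c] .
  have p: "p' = p"
    using inj_onD[OF chart_inj[OF c(1)]] v(3,4) v'(3,4) by metis
  have "v' d = l *\<^sub>R v d" for d
  proof (cases "d \<in> \<A> \<and> p \<in> fst d")
    case True
    then have D: "linear (frechet_derivative (transition c d) (at (snd c p)))"
      using c v(3) by (intro linear_frechet_derivative transition_differentiable) auto
    have w: "w d = frechet_derivative (transition c d) (at (snd c p)) (w c)"
      if "(p, w) \<in> tangent_bundle M \<A>" for w
      using that True c(1) v(3) unfolding tangent_bundle_def tangent_vector_def by blast
    show ?thesis
      using w[OF v(2)] w[OF v'(2)[unfolded p]] v(5) v'(5) by (simp only: linear_cmul[OF D])
  next
    case False
    then have w: "w d = 0" if "(p, w) \<in> tangent_bundle M \<A>" for w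
      using that unfolding tangent_bundle_def tangent_vector_def by blast
    show ?thesis using w[OF v(2)] w[OF v'(2)[unfolded p]] by simp
  qed
  then have "v' = (\<lambda>d. l *\<^sub>R v d)" by blast
  then show ?thesis
    using F[OF v(2) l] by (simp add: in_coords_def v(1) v'(1) p)
qed

lemma AR_chart_in_coords:
  assumes AR: "AR_Finsler_metric M \<A> F \<eta> a" and c: "c \<in> \<A>"
  shows "AR_chart (chart_image c) (in_coords M \<A> c F) (in_coords M \<A> c \<eta>) (a c)"
proof
  have F: "Finsler_metric M \<A> F"
    using AR unfolding AR_Finsler_metric_def by blast
  show "open (chart_image c)" by (rule chart_homeomorphic(3)[OF c])
  show "smooth_slit (chart_image c) (in_coords M \<A> c F)"
    using F c unfolding Finsler_metric_def smooth_on_slit_def by blast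
  show "smooth_slit (chart_image c) (in_coords M \<A> c \<eta>)"
    using AR c unfolding AR_Finsler_metric_def smooth_on_slit_def by blast
  show "rational_in_y (chart_image c) (\<lambda>x y. a c x y $ i $ j)" for i j
    using AR c unfolding AR_Finsler_metric_def by blast
  show "in_coords M \<A> c F x (l *\<^sub>R y) = l * in_coords M \<A> c F x y"
    if "x \<in> chart_image c" "l > 0" for x y l
  proof (rule in_coords_homogeneous[OF _ c that])
    show "F (p, \<lambda>c. l *\<^sub>R v c) = l * F (p, v)" if "(p, v) \<in> tangent_bundle M \<A>" "l > 0" for p v l
      using F that unfolding Finsler_metric_def by blast
  qed
  fix x y assume xy: "x \<in> chart_image c" "y \<noteq> (0 :: real ^ 'n)"
  show "pos_def (fundamental_tensor (in_coords M \<A> c F) x y)"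
    using F c xy unfolding Finsler_metric_def by blast
  show "fundamental_tensor (in_coords M \<A> c F) x y = in_coords M \<A> c \<eta> x y *\<^sub>R a c x y"
    and "transpose (a c x y) = a c x y" and "pos_def (a c x y)"
    using AR c xy unfolding AR_Finsler_metric_def by simp_all
qed

end

theorem proposition3p13:
  fixes M :: "'m topology" and \<A> :: "('m, 'n::finite) chart set"
    and F \<eta> :: "'m \<times> ('m, 'n) tvec \<Rightarrow> real"
    and a :: "('m, 'n) chart \<Rightarrow> real ^ 'n \<Rightarrow> real ^ 'n \<Rightarrow> real ^ 'n ^ 'n"
  assumes "smooth_manifold M \<A>"
    and "AR_Finsler_metric M \<A> F \<eta> a"
  shows "\<forall>c\<in>\<A>.
    (let N = barthel (in_coords M \<A> c F);
         L = (\<lambda>x y. ln (in_coords M \<A> c \<eta> x y));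
         al = (\<lambda>i j x y. a c x y $ i $ j);
         au = (\<lambda>i j x y. matrix_inv (a c x y) $ i $ j)
     in
      (\<forall>x\<in>chart_image c. \<forall>y. y \<noteq> 0 \<longrightarrow> (\<forall>i j.
         N j i x y =
           1/2 * (y $ j * dx i L x y + (if j = i then 1 else 0) * (\<Sum>k\<in>UNIV. y $ k * dx k L x y))
           - 1/4 * (\<Sum>l\<in>UNIV. \<Sum>r\<in>UNIV. y $ r *
               (2 * al i r x y * au j l x y +
                (\<Sum>s\<in>UNIV. y $ s * (au j l x y * dy i (al r s) x y + al r s x y * dy i (au j l) x y)))
               * dx l L x y)
           + 1/2 * (\<Sum>l\<in>UNIV.
               (y $ j * y $ l - 1/2 * (\<Sum>r\<in>UNIV. \<Sum>s\<in>UNIV. y $ r * y $ s * al r s x y * au j l x y))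
               * dy i (dx l L) x y)
           + 1/2 * dy i (\<lambda>x y. \<Sum>k\<in>UNIV. \<Sum>s\<in>UNIV. \<Sum>l\<in>UNIV. y $ k * y $ s * au l j x y *
               (dx k (al l s) x y - 1/2 * dx l (al k s) x y)) x y)) \<and>
      ((\<forall>i j. rational_in_y (chart_image c) (N i j)) \<longleftrightarrow>
       (\<forall>k. rational_in_y (chart_image c) (dx k L))))"
proof (rule ballI, goal_cases)
  case (1 c)
  then interpret AR_chart "chart_image c" "in_coords M \<A> c F" "in_coords M \<A> c \<eta>" "a c"
    by (rule AR_chart_in_coords[OF assms])
  show ?case
    unfolding Let_def
    using barthel_formula[unfolded residual_spray_def[abs_def]] barthel_rational_iff by (intro conjI ballI allI impI)
qed

end
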